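(* Let $a\ge b\ge 0$ be integers and let $\pi_\lambda$ be the irreducible representation of $\mathrm{GL}_3(\mathbb{C})$ with highest weight $\lambda=a\omega_1+b\omega_2$. Let $\pi_\lambda(\mathrm{Sym}^2)$ denote the $\mathrm{SL}_2(\mathbb{C})$-module obtained by composing $\pi_\lambda$ with $\mathrm{Sym}^2:\mathrm{SL}_2(\mathbb{C})\to\mathrm{GL}_3(\mathbb{C})$. Define $$s=a+b,\qquad r=2s+2,\qquad p=\Bigl\lfloor \tfrac{s}{2}\Bigr\rfloor,\qquad t=\Bigl\lfloor \tfrac{b}{2}\Bigr\rfloor .$$ Then $\pi_\lambda(\mathrm{Sym}^2)$ decomposes as an $\mathrm{SL}_2(\mathbb{C})$-module as follows. If $b=0$, then $\pi_\lambda(\mathrm{Sym}^2)=\sum_{k=0}^{p}[2a-4k+1]$. Suppose $b\ge 1$. (1) If $b$ is odd, then $\pi_\lambda(\mathrm{Sym}^2)$ equals $$\sum_{k=1}^{t} k\bigl([4k-1]+[4k+1]+[r-4k+1]+[r-4k+3]\bigr)+(t+1)\sum_{j=2t+1}^{s-2t}[2j+1].$$ (2) If $a$ is odd and $b$ is even, then $\pi_\lambda(\mathrm{Sym}^2)$ equals $$\sum_{k=1}^{t} k\bigl([4k-1]+[4k+1]+[r-4k+1]+[r-4k+3]\bigr)+t\sum_{j=2t+1}^{s-2t}[2j+1]+\sum_{j=t}^{p-t}[4j+3].$$ (3) If $a$ and $b$ are both even, then $\pi_\lambda(\mathrm{Sym}^2)$ equals $$\sum_{k=1}^{t-1} k\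bigl([4k+1]+[4k+3]+[r-4k+1]+[r-4k+3]\bigr)+t\sum_{j=2t}^{s-2t+2}[2j+1]+\sum_{k=0}^{\frac{s-2t}{2}}[4k+1].$$
   Context: $\omega_1,\omega_2$ are the fundamental weights of $\mathrm{GL}_3(\mathbb{C})$ (the highest weights of $\mathbb{C}^3$ and $\Lambda^2\mathbb{C}^3$), so $\langle\omega_i,\alpha_j^\vee\rangle=\delta_{ij}$ for the simple coroots $\alpha_1^\vee,\alpha_2^\vee$. The homomorphism $\mathrm{Sym}^2:\mathrm{SL}_2(\mathbb{C})\to\mathrm{GL}_3(\mathbb{C})$ is the action on $\mathrm{Sym}^2(\mathbb{C}^2)\cong\mathbb{C}^3$ (the principal $\mathrm{SL}_2$). For an integer $k\ge 0$, $[k+1]$ denotes $\mathrm{Sym}^k=\mathrm{Sym}^k(\mathbb{C}^2)$, the $(k+1)$-dimensional irreducible representation of $\mathrm{SL}_2(\mathbb{C})$ (equivalently its character $z^k+z^{k-2}+\cdots+z^{-k}$ at $\mathrm{diag}(z,z^{-1})$). Sums denote direct sums, integer coefficients are multiplicities, equality means isomorphism of $\mathrm{SL}_2(\mathbb{C})$-modules (equality of characters), and empty sums are zero. *)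

theory Defs
  imports "HOL-Analysis.Analysis" "HOL-Library.Function_Algebras" "HOL-Library.Multiset"
begin

definition GL3 :: "(complex^3^3) set" where
  "GL3 = {g. invertible g}"

definition SL2 :: "(complex^2^2) set" where
  "SL2 = {g. det g = 1}"

text \<open>The underlying space is a subspace \<open>vecs\<close> of an ambient complex vector space, so that modules
  of varying dimension can be formed over one type. Only the values of \<open>act\<close> at elements of the
  group and of \<open>vecs\<close> matter.\<close>

record ('g, 'v) gmodule =
  vecs :: "'v set"
  scal :: "complex \<Rightarrow> 'v \<Rightarrow> 'v"
  act :: "'g \<Rightarrow> 'v \<Rightarrow> 'v"

definition representation ::
    "(complex^'n^'n) set \<Rightarrow> (complex^'n^'n, 'v::ab_group_add) gmodule \<Rightarrow> bool" where
  "representation G M \<longleftrightarrow>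
     vector_space (scal M) \<and>
     module.subspace (scal M) (vecs M) \<and>
     (\<exists>B. finite B \<and> vecs M = module.span (scal M) B) \<and>
     (\<forall>g\<in>G. \<forall>v\<in>vecs M. act M g v \<in> vecs M) \<and>
     (\<forall>g\<in>G. \<forall>v\<in>vecs M. \<forall>w\<in>vecs M. act M g (v + w) = act M g v + act M g w) \<and>
     (\<forall>g\<in>G. \<forall>c. \<forall>v\<in>vecs M. act M g (scal M c v) = scal M c (act M g v)) \<and>
     (\<forall>v\<in>vecs M. act M (mat 1) v = v) \<and>
     (\<forall>g\<in>G. \<forall>h\<in>G. \<forall>v\<in>vecs M. act M (g ** h) v = act M g (act M h v))"

definition irreducible_representation ::
    "(complex^'n^'n) set \<Rightarrow> (complex^'n^'n, 'v::ab_group_add) gmodule \<Rightarrow> bool" where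
  "irreducible_representation G M \<longleftrightarrow>
     representation G M \<and> vecs M \<noteq> {0} \<and>
     (\<forall>W. module.subspace (scal M) W \<and> W \<subseteq> vecs M \<and> (\<forall>g\<in>G. \<forall>v\<in>W. act M g v \<in> W)
        \<longrightarrow> W = {0} \<or> W = vecs M)"

inductive_set entry_polynomials :: "((complex^'n^'n) \<Rightarrow> complex) set" where
  const: "(\<lambda>g. c) \<in> entry_polynomials"
| entry: "(\<lambda>g. g $ i $ j) \<in> entry_polynomials"
| add: "P \<in> entry_polynomials \<Longrightarrow> Q \<in> entry_polynomials \<Longrightarrow> (\<lambda>g. P g + Q g) \<in> entry_polynomials"
| mult: "P \<in> entry_polynomials \<Longrightarrow> Q \<in> entry_polynomials \<Longrightarrow> (\<lambda>g. P g * Q g) \<in> entry_polynomials"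

text \<open>Rationality: every matrix coefficient lies in \<open>\<complex>[g\<^sub>i\<^sub>j, 1/det g]\<close>, the coordinate ring of
  the algebraic group.\<close>

definition rational_representation ::
    "(complex^'n^'n) set \<Rightarrow> (complex^'n^'n, 'v::ab_group_add) gmodule \<Rightarrow> bool" where
  "rational_representation G M \<longleftrightarrow>
     representation G M \<and>
     (\<forall>l. \<forall>v\<in>vecs M. Vector_Spaces.linear (scal M) (*) l \<longrightarrow>
        (\<exists>P\<in>entry_polynomials. \<exists>m. \<forall>g\<in>G. l (act M g v) = P g / det g ^ m))"

text \<open>Weights of the diagonal torus of \<open>GL\<^sub>3\<close> are integer vectors \<open>(l\<^sub>1, l\<^sub>2, l\<^sub>3)\<close>, standing for
  the character \<open>diag(t\<^sub>1, t\<^sub>2, t\<^sub>3) \<mapsto> t\<^sub>1\<^bsup>l\<^sub>1\<^esup> t\<^sub>2\<^bsup>l\<^sub>2\<^esup> t\<^sub>3\<^bsup>l\<^sub>3\<^esup>\<close>. Dominance is taken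
  with respect to the upper triangular Borel subgroup.\<close>

definition diag3 :: "complex^3 \<Rightarrow> complex^3^3" where
  "diag3 d = (\<chi> i j. if i = j then d $ i else 0)"

definition weight_character :: "int^3 \<Rightarrow> complex^3 \<Rightarrow> complex" where
  "weight_character l d = (\<Prod>i\<in>UNIV. d $ i powi (l $ i))"

definition omega1 :: "int^3" where "omega1 = vector [1, 0, 0]"
definition omega2 :: "int^3" where "omega2 = vector [1, 1, 0]"

text \<open>The conditions below the diagonal are spelled out because the order of the index type \<open>3\<close>
  has \<open>3 = 0\<close> as its least element.\<close>

definition upper_unitriangular3 :: "(complex^3^3) set" where
  "upper_unitriangular3 = {u. (\<forall>i. u $ i $ i = 1) \<and> u $ 2 $ 1 = 0 \<and> u $ 3 $ 1 = 0 \<and> u $ 3 $ 2 = 0}"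

definition highest_weight_vector ::
    "(complex^3^3, 'v::ab_group_add) gmodule \<Rightarrow> int^3 \<Rightarrow> 'v \<Rightarrow> bool" where
  "highest_weight_vector M l v \<longleftrightarrow>
     v \<in> vecs M \<and> v \<noteq> 0 \<and>
     (\<forall>u\<in>upper_unitriangular3. act M u v = v) \<and>
     (\<forall>d. (\<forall>i. d $ i \<noteq> 0) \<longrightarrow> act M (diag3 d) v = scal M (weight_character l d) v)"

definition irreducible_GL3_with_highest_weight ::
    "(complex^3^3, 'v::ab_group_add) gmodule \<Rightarrow> int^3 \<Rightarrow> bool" where
  "irreducible_GL3_with_highest_weight M l \<longleftrightarrow>
     irreducible_representation GL3 M \<and> rational_representation GL3 M \<and>
     (\<exists>v. highest_weight_vector M l v)"

text \<open>\<open>Sym\<^sup>k(\<complex>\<^sup>2)\<close> is the space of binary forms of degree \<open>k\<close> in the basis vectors \<open>e\<^sub>1, e\<^sub>2\<close>,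
  realised as functions of \<open>x\<close> with \<open>e\<^sub>i = (\<lambda>x. x $ i)\<close>. As
  \<open>(x v* g) $ j = x $ 1 * g $ 1 $ j + x $ 2 * g $ 2 $ j\<close>, the action sends \<open>e\<^sub>j\<close> to
  \<open>g\<^sub>1\<^sub>j e\<^sub>1 + g\<^sub>2\<^sub>j e\<^sub>2\<close>, as it should.\<close>

definition Sym :: "nat \<Rightarrow> (complex^2^2, complex^2 \<Rightarrow> complex) gmodule" where
  "Sym k = \<lparr> vecs = {f. \<exists>c. f = (\<lambda>x. \<Sum>i\<le>k. c i * (x $ 1) ^ (k - i) * (x $ 2) ^ i)},
             scal = (\<lambda>c f x. c * f x),
             act = (\<lambda>g f x. f (x v* g)) \<rparr>"

text \<open>The homomorphism \<open>Sym\<^sup>2 : SL\<^sub>2 \<rightarrow> GL\<^sub>3\<close>, in the basis \<open>e\<^sub>1\<^sup>2, e\<^sub>1e\<^sub>2, e\<^sub>2\<^sup>2\<close>.\<close>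

definition sym2 :: "complex^2^2 \<Rightarrow> complex^3^3" where
  "sym2 g = vector
     [vector [(g$1$1)\<^sup>2, g$1$1 * g$1$2, (g$1$2)\<^sup>2],
      vector [2 * g$1$1 * g$2$1, g$1$1 * g$2$2 + g$1$2 * g$2$1, 2 * g$1$2 * g$2$2],
      vector [(g$2$1)\<^sup>2, g$2$1 * g$2$2, (g$2$2)\<^sup>2]]"

definition quadratic_form :: "complex^3 \<Rightarrow> complex^2 \<Rightarrow> complex" where
  "quadratic_form c = (\<lambda>x. c $ 1 * (x $ 1)\<^sup>2 + c $ 2 * (x $ 1 * x $ 2) + c $ 3 * (x $ 2)\<^sup>2)"

lemma vecs_Sym_2: "vecs (Sym 2) = range quadratic_form"
proof -
  have "\<exists>c'. (\<lambda>x. \<Sum>i\<le>2. c i * (x $ 1) ^ (2 - i) * (x $ 2) ^ i) = quadratic_form c'"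
    for c :: "nat \<Rightarrow> complex"
    by (rule exI[of _ "vector [c 0, c 1, c 2]"])
      (simp add: fun_eq_iff quadratic_form_def vector_3 numeral_2_eq_2)
  moreover have "\<exists>c. quadratic_form c' = (\<lambda>x. \<Sum>i\<le>2. c i * (x $ 1) ^ (2 - i) * (x $ 2) ^ i)"
    for c'
    by (rule exI[of _ "\<lambda>i. if i = 0 then c' $ 1 else if i = 1 then c' $ 2 else c' $ 3"])
      (simp add: fun_eq_iff quadratic_form_def numeral_2_eq_2)
  ultimately show ?thesis
    unfolding Sym_def by (auto simp: image_iff)
qed

lemma act_Sym_2: "act (Sym 2) g (quadratic_form c) = quadratic_form (sym2 g *v c)"
  by (simp add: Sym_def quadratic_form_def sym2_def fun_eq_iff vector_matrix_mult_def
      matrix_vector_mult_def sum_2 sum_3 vector_3 power2_eq_square algebra_simps)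

lemma sym2_mult: "sym2 (g ** h) = sym2 g ** sym2 h"
  by (simp add: sym2_def vec_eq_iff forall_3 matrix_matrix_mult_def sum_2 sum_3 vector_3
      power2_eq_square algebra_simps)

lemma det_sym2: "det (sym2 g) = det g ^ 3"
  by (simp add: sym2_def det_3 det_2 vector_3 power2_eq_square power3_eq_cube algebra_simps)

lemma sym2_in_GL3: "g \<in> SL2 \<Longrightarrow> sym2 g \<in> GL3"
  by (simp add: SL2_def GL3_def invertible_det_nz det_sym2)

definition pullback :: "('h \<Rightarrow> 'g) \<Rightarrow> ('g, 'v) gmodule \<Rightarrow> ('h, 'v) gmodule" where
  "pullback \<phi> M = \<lparr> vecs = vecs M, scal = scal M, act = (\<lambda>h. act M (\<phi> h)) \<rparr>"

text \<open>\<open>irr_sum N\<close> is the external direct sum of the modules \<open>[n] = Sym\<^sup>n\<^sup>-\<^sup>1(\<complex>\<^sup>2)\<close>, where \<open>n\<close> runs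
  through the multiset \<open>N\<close> of positive integers (the dimensions); the summands are indexed by
  the pairs \<open>(n, i)\<close> with \<open>i < count N n\<close>.\<close>

definition irr_sum ::
    "nat multiset \<Rightarrow> (complex^2^2, nat \<times> nat \<Rightarrow> complex^2 \<Rightarrow> complex) gmodule" where
  "irr_sum N =
     \<lparr> vecs = {f. \<forall>n i. (i < count N n \<longrightarrow> f (n, i) \<in> vecs (Sym (n - 1))) \<and>
                         (\<not> i < count N n \<longrightarrow> f (n, i) = 0)},
       scal = (\<lambda>c f (n, i). scal (Sym (n - 1)) c (f (n, i))),
       act = (\<lambda>g f (n, i). act (Sym (n - 1)) g (f (n, i))) \<rparr>"

definition isomorphic_gmodules ::
    "'g set \<Rightarrow> ('g, 'v::ab_group_add) gmodule \<Rightarrow> ('g, 'w::ab_group_add) gmodule \<Rightarrow> bool" where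
  "isomorphic_gmodules G M N \<longleftrightarrow>
     (\<exists>\<phi>. bij_betw \<phi> (vecs M) (vecs N) \<and>
          (\<forall>v\<in>vecs M. \<forall>w\<in>vecs M. \<phi> (v + w) = \<phi> v + \<phi> w) \<and>
          (\<forall>c. \<forall>v\<in>vecs M. \<phi> (scal M c v) = scal N c (\<phi> v)) \<and>
          (\<forall>g\<in>G. \<forall>v\<in>vecs M. \<phi> (act M g v) = act N g (\<phi> v)))"

end

theory Submission
  imports Defs
begin

text \<open>Let \<open>v\<close> be a highest weight vector. On the big cell \<open>N\<^sup>- T N\<close>, letting a one-parameter
  subgroup of the torus contract \<open>N\<^sup>-\<close> shows that every linear relation between the vectors \<open>h v\<close> also
  holds between the functions \<open>g \<mapsto> \<Delta>\<^sub>1(g h)\<^sup>a \<Delta>\<^sub>2(g h)\<^sup>b\<close> of the leading minors; irreducibility gives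
  the converse. As \<open>\<Delta>\<^sub>1(g h)\<close> and \<open>\<Delta>\<^sub>2(g h)\<close> are pairings of \<open>g\<close> with the point \<open>(x, y)\<close> of the cone
  \<open>x \<cdot> y = 0\<close> formed by the first column of \<open>h\<close> and its cross product with the second, a positive
  definiteness argument identifies these relations with those between evaluations at \<open>(x, y)\<close> of all
  polynomials of bidegree \<open>(a, b)\<close>.

  Under the principal \<open>SL\<^sub>2\<close> both \<open>x\<close> and \<open>y\<close> become binary quadratic forms \<open>F\<close> and \<open>G\<close>, and the
  covariants \<open>F\<^sup>i G\<^sup>j J\<^sup>e disc(F)\<^sup>k disc(G)\<^sup>l\<close> with \<open>e \<le> 1\<close>, \<open>i + 2k + e = a\<close>, \<open>j + 2l + e = b\<close>, where
  \<open>J\<close> is the Jacobian of \<open>F\<close> and \<open>G\<close>, each contribute a summand \<open>[2(i + j + e) + 1]\<close>. Their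
  coefficients are linearly independent on the cone, and their number equals the dimension of the space of
  polynomials of bidegree \<open>(a, b)\<close> modulo \<open>x \<cdot> y\<close>, so that the module is the sum of these summands.\<close>

section \<open>Polynomial functions of matrices\<close>

lemma entry_poly_sum: "finite A \<Longrightarrow> (\<And>x. x \<in> A \<Longrightarrow> P x \<in> entry_polynomials) \<Longrightarrow> (\<lambda>g. \<Sum>x\<in>A. P x g) \<in> entry_polynomials"
proof (induction A rule: finite_induct)
  case empty
  show ?case using entry_polynomials.const[of 0] by simp
next
  case (insert x A)
  then show ?case by (simp add: entry_polynomials.add)
qed

lemma entry_poly_prod: "finite A \<Longrightarrow> (\<And>x. x \<in> A \<Longrightarrow> P x \<in> entry_polynomials) \<Longrightarrow> (\<lambda>g. \<Prod>x\<in>A. P x g) \<in> entry_polynomials"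
proof (induction A rule: finite_induct)
  case empty
  show ?case using entry_polynomials.const[of 1] by simp
next
  case (insert x A)
  then show ?case by (simp add: entry_polynomials.mult)
qed

lemma entry_poly_power: "P \<in> entry_polynomials \<Longrightarrow> (\<lambda>g. P g ^ n) \<in> entry_polynomials"
  using entry_poly_prod[of "{..<n}" "\<lambda>_. P"] by simp

lemma entry_poly_diff:
  assumes "P \<in> entry_polynomials" "Q \<in> entry_polynomials"
  shows "(\<lambda>g. P g - Q g) \<in> entry_polynomials"
  using entry_polynomials.add[OF assms(1) entry_polynomials.mult[OF entry_polynomials.const[of "-1"] assms(2)]]
  by simp

lemma entry_poly_translate: "(\<lambda>g. (g ** h) $ i $ j) \<in> entry_polynomials"
  unfolding matrix_matrix_mult_def
  by (simp, intro entry_poly_sum entry_polynomials.mult entry_polynomials.entry entry_polynomials.const) simp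

text \<open>Restriction to a polynomial curve reduces questions about matrix polynomials to one
  variable. It is applied to lines joining two matrices and to the contraction of lower
  unitriangular factors.\<close>

lemma entry_poly_along_curve:
  fixes P :: "complex^'n^'n \<Rightarrow> complex"
  assumes "P \<in> entry_polynomials" and M: "\<And>i j. \<exists>p. \<forall>t. M t $ i $ j = poly p t"
  shows "\<exists>p. \<forall>t. P (M t) = poly p t"
  using assms(1)
proof induction
  case (const c)
  show ?case by (rule exI[of _ "[:c:]"]) simp
next
  case (entry i j)
  show ?case by (rule M)
next
  case (add P Q)
  then obtain p q where "\<forall>t. P (M t) = poly p t" "\<forall>t. Q (M t) = poly q t" by blast
  then show ?case by (intro exI[of _ "p + q"]) simp
next
  case (mult P Q)
  then obtain p q where "\<forall>t. P (M t) = poly p t" "\<forall>t. Q (M t) = poly q t" by blast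
  then show ?case by (intro exI[of _ "p * q"]) simp
qed

text \<open>Matrix polynomials have no zero divisors: on the line through \<open>g\<close> and
  \<open>h\<close> both become nonzero univariate polynomials, and their product has only finitely
  many roots.\<close>

lemma entry_poly_mult_nonzero:
  fixes P Q :: "complex^'n^'n \<Rightarrow> complex"
  assumes "P \<in> entry_polynomials" "Q \<in> entry_polynomials" "P g \<noteq> 0" "Q h \<noteq> 0"
  shows "\<exists>k. P k \<noteq> 0 \<and> Q k \<noteq> 0"
proof -
  define M where "M t = (\<chi> i j. g $ i $ j + t * (h $ i $ j - g $ i $ j))" for t
  have M: "\<exists>p. \<forall>t. M t $ i $ j = poly p t" for i j
    by (rule exI[of _ "[:g $ i $ j, h $ i $ j - g $ i $ j:]"]) (simp add: M_def)
  obtain p q where p: "\<And>t. P (M t) = poly p t" and q: "\<And>t. Q (M t) = poly q t"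
    using entry_poly_along_curve[OF assms(1) M] entry_poly_along_curve[OF assms(2) M] by blast
  have "M 0 = g" "M 1 = h" by (simp_all add: M_def vec_eq_iff)
  then have "poly p 0 \<noteq> 0" "poly q 1 \<noteq> 0"
    using assms(3,4) p[of 0] q[of 1] by auto
  then have "p * q \<noteq> 0" by auto
  then have "finite {t. poly (p * q) t = 0}" by (rule poly_roots_finite)
  then obtain t where "poly (p * q) t \<noteq> 0"
    using ex_new_if_finite[OF infinite_UNIV_char_0] by blast
  then show ?thesis using p q by (intro exI[of _ "M t"]) simp
qed

lemma entry_poly_prod_nonzero:
  fixes P :: "'a \<Rightarrow> complex^'n^'n \<Rightarrow> complex"
  assumes "finite A" "\<And>x. x \<in> A \<Longrightarrow> P x \<in> entry_polynomials" "\<And>x. x \<in> A \<Longrightarrow> \<exists>g. P x g \<noteq> 0"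
  shows "\<exists>g. (\<Prod>x\<in>A. P x g) \<noteq> 0"
  using assms
proof (induction A rule: finite_induct)
  case (insert x A)
  from insert.IH insert.prems obtain g h where "(\<Prod>x\<in>A. P x g) \<noteq> 0" "P x h \<noteq> 0" by blast
  then obtain k where "P x k \<noteq> 0 \<and> (\<Prod>x\<in>A. P x k) \<noteq> 0"
    using entry_poly_mult_nonzero[of "P x" "\<lambda>g. \<Prod>x\<in>A. P x g" h g] insert.prems insert.hyps
      entry_poly_prod[of A P] by auto
  then show ?case using insert.hyps by (intro exI[of _ k]) simp
qed simp

text \<open>Zariski density of the locus \<open>P g \<noteq> 0\<close>, in the form that allows
  identities to be checked only where all relevant matrices lie in the big cell.\<close>

lemma entry_poly_eq_zero_if_mult:
  fixes P Q :: "complex^'n^'n \<Rightarrow> complex"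
  assumes "P \<in> entry_polynomials" "Q \<in> entry_polynomials" "P g \<noteq> 0"
    and "\<And>g. P g \<noteq> 0 \<Longrightarrow> Q g = 0"
  shows "Q h = 0"
  using entry_poly_mult_nonzero[OF assms(1,2,3)] assms(4) by blast

section \<open>Leading minors and the big cell\<close>

definition minor12 :: "complex^3^3 \<Rightarrow> complex" where
  "minor12 g = g $ 1 $ 1 * g $ 2 $ 2 - g $ 1 $ 2 * g $ 2 $ 1"

definition flag_monomial :: "nat \<Rightarrow> nat \<Rightarrow> complex^3^3 \<Rightarrow> complex" where
  "flag_monomial a b g = (g $ 1 $ 1) ^ a * minor12 g ^ b"

lemma entry_poly_minor12: "(\<lambda>g. minor12 (g ** h)) \<in> entry_polynomials"
  unfolding minor12_def by (intro entry_poly_diff entry_polynomials.mult entry_poly_translate)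

lemma entry_poly_det: "(\<lambda>g. det (g ** h :: complex^3^3)) \<in> entry_polynomials"
  unfolding det_3
  by (intro entry_poly_diff entry_polynomials.add entry_polynomials.mult entry_poly_translate)

lemma entry_poly_flag_monomial: "(\<lambda>g. flag_monomial a b (g ** h)) \<in> entry_polynomials"
  unfolding flag_monomial_def
  by (intro entry_poly_power entry_polynomials.mult entry_poly_translate entry_poly_minor12)

text \<open>Gaussian elimination without pivoting; the pivots are the ratios of consecutive leading
  minors.\<close>

lemma big_cell_decomposition:
  fixes h :: "complex^3^3"
  assumes "h $ 1 $ 1 \<noteq> 0" "minor12 h \<noteq> 0"
  shows "\<exists>p q r. \<exists>u\<in>upper_unitriangular3.
    h = vector [vector [1, 0, 0], vector [p, 1, 0], vector [q, r, 1]]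
      ** (diag3 (vector [h $ 1 $ 1, minor12 h / h $ 1 $ 1, det h / minor12 h]) ** u)"
proof -
  let ?a = "h $ 1 $ 1" let ?m = "minor12 h"
  define u :: "complex^3^3" where "u = vector [vector [1, h $ 1 $ 2 / ?a, h $ 1 $ 3 / ?a],
     vector [0, 1, (?a * h $ 2 $ 3 - h $ 1 $ 3 * h $ 2 $ 1) / ?m], vector [0, 0, 1]]"
  define p where "p = h $ 2 $ 1 / ?a"
  define q where "q = h $ 3 $ 1 / ?a"
  define r where "r = (?a * h $ 3 $ 2 - h $ 1 $ 2 * h $ 3 $ 1) / ?m"
  have "u \<in> upper_unitriangular3"
    by (simp add: upper_unitriangular3_def u_def vector_3 forall_3)
  moreover have "h = vector [vector [1, 0, 0], vector [p, 1, 0], vector [q, r, 1]]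
      ** (diag3 (vector [?a, ?m / ?a, det h / ?m]) ** u)"
    using assms
    apply (simp add: vec_eq_iff forall_3 matrix_matrix_mult_def sum_3 vector_3 diag3_def u_def p_def q_def r_def)
    apply (simp add: field_simps det_3)
    apply (simp add: minor12_def algebra_simps)
    done
  ultimately show ?thesis by blast
qed

section \<open>Linear relations in the orbit of a highest weight vector\<close>

text \<open>Choose a basis from among the vectors \<open>\<psi> x\<close>, prescribe
  \<open>T\<close> on it, and express every other \<open>\<psi> x\<close> in that basis: this is a
  linear relation, so by hypothesis the vectors \<open>\<eta> x\<close> satisfy it too.\<close>

lemma linear_map_from_relations:
  fixes s1 :: "'k::field \<Rightarrow> 'v::ab_group_add \<Rightarrow> 'v" and s2 :: "'k \<Rightarrow> 'w::ab_group_add \<Rightarrow> 'w"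
  assumes "vector_space s1" "vector_space s2"
    and rel: "\<And>A c. finite A \<Longrightarrow> A \<subseteq> X \<Longrightarrow> (\<Sum>x\<in>A. s1 (c x) (\<psi> x)) = 0 \<Longrightarrow> (\<Sum>x\<in>A. s2 (c x) (\<eta> x)) = 0"
  shows "\<exists>T. Vector_Spaces.linear s1 s2 T \<and> (\<forall>x\<in>X. T (\<psi> x) = \<eta> x)"
proof -
  interpret vector_space_pair s1 s2 using assms(1,2) by (simp add: vector_space_pair_def)
  obtain B where B: "B \<subseteq> \<psi> ` X" "vs1.independent B" "\<psi> ` X \<subseteq> vs1.span B"
    using vs1.maximal_independent_subset by blast
  \<comment> \<open>One index per basis vector, since \<open>\<psi>\<close> need not be injective on
    \<open>X\<close>.\<close>
  define \<sigma> where "\<sigma> = inv_into X \<psi>"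
  have \<sigma>: "\<sigma> b \<in> X" "\<psi> (\<sigma> b) = b" if "b \<in> B" for b
    using that B(1) by (auto simp: \<sigma>_def inv_into_into f_inv_into_f subset_iff)
  obtain T where T: "Vector_Spaces.linear s1 s2 T" "\<forall>b\<in>B. T b = \<eta> (\<sigma> b)"
    using linear_independent_extend[OF B(2), of "\<eta> \<circ> \<sigma>"] by auto
  interpret T: Vector_Spaces.linear s1 s2 T by (rule T(1))
  have "T (\<psi> x) = \<eta> x" if "x \<in> X" for x
  proof -
    have "\<psi> x \<in> vs1.span B" using that B(3) by blast
    then obtain C r where C: "finite C" "C \<subseteq> B" and r: "\<psi> x = (\<Sum>b\<in>C. s1 (r b) b)"
      unfolding vs1.span_explicit by blast
    define A where "A = insert x (\<sigma> ` C)"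
    \<comment> \<open>The coefficients of the relation expressing \<open>\<psi> x\<close> in the
      basis, as a function of indices. Both terms contribute when \<open>x\<close> is itself one of
      the chosen indices.\<close>
    define c where "c y = (if y = x then 1 else 0) - (if y \<in> \<sigma> ` C then r (\<psi> y) else 0)" for y
    have inj: "inj_on \<sigma> C" using \<sigma>(2) C(2) by (metis inj_onI subsetD)
    have A: "finite A" "A \<subseteq> X" using C \<sigma>(1) that by (auto simp: A_def)
    \<comment> \<open>Generic in the target space, so that the same bookkeeping serves
      \<open>s1\<close> and \<open>s2\<close>.\<close>
    have split: "(\<Sum>y\<in>A. s (c y) (f y)) = f x - (\<Sum>b\<in>C. s (r b) (f (\<sigma> b)))"
      if "vector_space s" for s :: "'k \<Rightarrow> 'z::ab_group_add \<Rightarrow> 'z" and f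
    proof -
      interpret V: vector_space s by (rule that)
      have "(\<Sum>y\<in>A. s (c y) (f y)) = (\<Sum>y\<in>A. if y = x then f y else 0)
          - (\<Sum>y\<in>A. if y \<in> \<sigma> ` C then s (r (\<psi> y)) (f y) else 0)"
        unfolding sum_subtractf[symmetric] c_def
        by (rule sum.cong) (auto simp: V.scale_left_diff_distrib)
      also have "(\<Sum>y\<in>A. if y = x then f y else 0) = f x"
        using A(1) by (simp add: A_def)
      also have "(\<Sum>y\<in>A. if y \<in> \<sigma> ` C then s (r (\<psi> y)) (f y) else 0) = (\<Sum>y\<in>\<sigma> ` C. s (r (\<psi> y)) (f y))"
        using A(1) by (simp add: sum.inter_restrict[symmetric] A_def Int_absorb1 subset_insertI)
      also have "\<dots> = (\<Sum>b\<in>C. s (r b) (f (\<sigma> b)))"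
        using C(2) \<sigma>(2) by (subst sum.reindex[OF inj]) (auto intro!: sum.cong)
      finally show ?thesis .
    qed
    have "(\<Sum>y\<in>A. s1 (c y) (\<psi> y)) = \<psi> x - (\<Sum>b\<in>C. s1 (r b) b)"
      using C(2) \<sigma>(2) by (subst split[OF assms(1)]) (auto intro!: sum.cong)
    then have "(\<Sum>y\<in>A. s2 (c y) (\<eta> y)) = 0" using rel[OF A] r by simp
    then have "\<eta> x = (\<Sum>b\<in>C. s2 (r b) (\<eta> (\<sigma> b)))" by (simp add: split[OF assms(2)])
    also have "\<dots> = T (\<psi> x)"
      using T(2) C(2) by (auto simp: r T.sum T.scale intro!: sum.cong)
    finally show ?thesis by simp
  qed
  then show ?thesis using T(1) by blast
qed

section \<open>Elementary facts on representations and weights\<close>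

lemma rep_vector_space: "representation G M \<Longrightarrow> vector_space (scal M)"
  and rep_subspace: "representation G M \<Longrightarrow> module.subspace (scal M) (vecs M)"
  unfolding representation_def by blast+

lemma rep_closed:
  "representation G M \<Longrightarrow> g \<in> G \<Longrightarrow> w \<in> vecs M \<Longrightarrow> act M g w \<in> vecs M"
  and rep_mult: "representation G M \<Longrightarrow> g \<in> G \<Longrightarrow> h \<in> G \<Longrightarrow> w \<in> vecs M \<Longrightarrow>
    act M (g ** h) w = act M g (act M h w)"
  and rep_scal: "representation G M \<Longrightarrow> g \<in> G \<Longrightarrow> w \<in> vecs M \<Longrightarrow>
    act M g (scal M k w) = scal M k (act M g w)"
  and rep_add: "representation G M \<Longrightarrow> g \<in> G \<Longrightarrow> w \<in> vecs M \<Longrightarrow> w' \<in> vecs M \<Longrightarrow>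
    act M g (w + w') = act M g w + act M g w'"
  unfolding representation_def by simp_all

lemma rep_act_sum:
  assumes "representation G M" "g \<in> G" "finite A" "\<And>x. x \<in> A \<Longrightarrow> w x \<in> vecs M"
  shows "act M g (\<Sum>x\<in>A. scal M (c x) (w x)) = (\<Sum>x\<in>A. scal M (c x) (act M g (w x)))"
  using assms(3,4)
proof (induction A rule: finite_induct)
  interpret vector_space "scal M" by (rule rep_vector_space[OF assms(1)])
  note sub = rep_subspace[OF assms(1)]
  case empty
  have "0 \<in> vecs M" by (rule subspace_0[OF sub])
  then have "act M g (scal M 0 0) = scal M 0 (act M g 0)"
    by (rule rep_scal[OF assms(1,2)])
  then show ?case by simp
next
  interpret vector_space "scal M" by (rule rep_vector_space[OF assms(1)])
  note sub = rep_subspace[OF assms(1)]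
  case (insert x A)
  have "scal M (c x) (w x) \<in> vecs M" "(\<Sum>x\<in>A. scal M (c x) (w x)) \<in> vecs M"
    using insert.prems by (auto intro!: subspace_scale[OF sub] subspace_sum[OF sub])
  then have "act M g (scal M (c x) (w x) + (\<Sum>x\<in>A. scal M (c x) (w x)))
      = act M g (scal M (c x) (w x)) + act M g (\<Sum>x\<in>A. scal M (c x) (w x))"
    by (rule rep_add[OF assms(1,2)])
  moreover have "act M g (scal M (c x) (w x)) = scal M (c x) (act M g (w x))"
    using insert.prems by (intro rep_scal[OF assms(1,2)]) simp
  ultimately show ?case using insert by simp
qed

lemma GL3_mult: "g \<in> GL3 \<Longrightarrow> h \<in> GL3 \<Longrightarrow> g ** h \<in> GL3"
  by (simp add: GL3_def invertible_mult)

lemma GL3_iff: "g \<in> GL3 \<longleftrightarrow> det g \<noteq> 0"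
  by (simp add: GL3_def invertible_det_nz)

lemma upper_unitriangular3_GL3: "u \<in> upper_unitriangular3 \<Longrightarrow> u \<in> GL3"
  by (simp add: GL3_iff det_3 upper_unitriangular3_def)

lemma det_diag3: "det (diag3 d) = d $ 1 * d $ 2 * d $ 3"
  by (simp add: diag3_def det_3)

lemma weight_character_dominant:
  "weight_character (int a *s omega1 + int b *s omega2) d = d $ 1 ^ (a + b) * d $ 2 ^ b"
proof -
  have "(int a *s omega1 + int b *s omega2) $ 1 = int (a + b)"
    "(int a *s omega1 + int b *s omega2) $ 2 = int b" "(int a *s omega1 + int b *s omega2) $ 3 = 0"
    by (simp_all add: omega1_def omega2_def)
  then show ?thesis
    by (simp only: weight_character_def UNIV_3) (simp del: of_nat_add)
qed

text \<open>For generic \<open>g\<close> each \<open>g ** h\<close> is a product of a lower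
  unitriangular, a diagonal and an upper unitriangular matrix; on \<open>v\<close> the last acts
  trivially and the middle one by the scalar \<open>flag_monomial a b (g ** h)\<close>. Conjugation
  by a one-parameter subgroup of the torus degenerates the lower factors to the identity, so that
  only these scalars remain.\<close>

lemma flag_monomial_relations:
  fixes M :: "(complex^3^3, 'v::ab_group_add) gmodule"
  assumes rat: "rational_representation GL3 M"
    and hw: "highest_weight_vector M (int a *s omega1 + int b *s omega2) v"
    and A: "finite A" "A \<subseteq> GL3"
    and rel: "(\<Sum>h\<in>A. scal M (c h) (act M h v)) = 0"
  shows "(\<Sum>h\<in>A. c h * flag_monomial a b (g ** h)) = 0"
proof -
  have rep: "representation GL3 M" using rat by (simp add: rational_representation_def)
  interpret V: vector_space "scal M" by (rule rep_vector_space[OF rep])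
  interpret vector_space_pair "scal M" "(*) :: complex \<Rightarrow> complex \<Rightarrow> complex"
    by unfold_locales (auto simp: algebra_simps)
  have v: "v \<in> vecs M" "v \<noteq> 0" using hw by (auto simp: highest_weight_vector_def)
  note mult = rep_mult[OF rep] and closed = rep_closed[OF rep]
    and act_scal = rep_scal[OF rep]
  have torus: "act M (diag3 d) v = scal M (d $ 1 ^ (a + b) * d $ 2 ^ b) v"
    if "\<forall>i. d $ i \<noteq> 0" for d
    using hw that by (simp add: highest_weight_vector_def weight_character_dominant)
  have unip: "act M u v = v" if "u \<in> upper_unitriangular3" for u
    using hw that by (simp add: highest_weight_vector_def)
  have one: "act M (mat 1) v = v" using rep v by (simp add: representation_def)
  have "V.independent {v}" using v by simp
  \<comment> \<open>The functional is normalised so that its matrix coefficient at \<open>v\<close>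
    takes the value \<open>1\<close> at the identity.\<close>
  then obtain l where l: "Vector_Spaces.linear (scal M) (*) l" "l v = 1"
    using linear_independent_extend[of "{v}" "\<lambda>_. 1"] by auto
  interpret l: Vector_Spaces.linear "scal M" "(*)" l by (rule l(1))
  obtain P m where P: "P \<in> entry_polynomials" and Pm: "\<And>g. g \<in> GL3 \<Longrightarrow> l (act M g v) = P g / det g ^ m"
    using rat l(1) v(1) unfolding rational_representation_def by blast
  have P1: "P (mat 1) = 1" using Pm[of "mat 1"] one l(2) by (simp add: GL3_iff)
  define Q where "Q g = (\<Sum>h\<in>A. c h * flag_monomial a b (g ** h))" for g
  \<comment> \<open>\<open>D g\<close> is nonzero exactly when \<open>g\<close> is invertible and
    every \<open>g ** h\<close> with \<open>h \<in> A\<close> lies in the big cell.\<close>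
  define D where "D g = (\<Prod>h\<in>A. (g ** h) $ 1 $ 1 * minor12 (g ** h) * det (g ** h)) * det (g ** mat 1)" for g
  have Q: "Q \<in> entry_polynomials"
    unfolding Q_def using A(1)
    by (intro entry_poly_sum entry_polynomials.mult entry_polynomials.const entry_poly_flag_monomial)
  have factor: "(\<lambda>g. (g ** h) $ 1 $ 1 * minor12 (g ** h) * det (g ** h)) \<in> entry_polynomials" for h :: "complex^3^3"
    by (intro entry_polynomials.mult entry_poly_translate entry_poly_minor12 entry_poly_det)
  have D: "D \<in> entry_polynomials"
    unfolding D_def using A(1)
    by (intro entry_polynomials.mult[OF _ entry_poly_det] entry_poly_prod factor)
  \<comment> \<open>Taking \<open>g\<close> to be the inverse of \<open>h\<close> makes every factor
    equal to \<open>1\<close>.\<close>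
  have "\<exists>g. (g ** h) $ 1 $ 1 * minor12 (g ** h) * det (g ** h) \<noteq> 0" if "h \<in> A" for h
  proof -
    have "invertible h" using that A(2) by (auto simp: GL3_def)
    then obtain k where "k ** h = mat 1" unfolding invertible_def by blast
    then show ?thesis by (intro exI[of _ k]) (simp add: minor12_def mat_def det_3)
  qed
  then obtain g1 where g1: "(\<Prod>h\<in>A. (g1 ** h) $ 1 $ 1 * minor12 (g1 ** h) * det (g1 ** h)) \<noteq> 0"
    using entry_poly_prod_nonzero[OF A(1), of "\<lambda>h g. (g ** h) $ 1 $ 1 * minor12 (g ** h) * det (g ** h)"] factor
    by blast
  have "\<exists>g. D g \<noteq> 0"
    using entry_poly_mult_nonzero[OF entry_poly_prod[OF A(1) factor] entry_poly_det[of "mat 1"] g1, of "mat 1"]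
    unfolding D_def by auto
  then obtain g0 where g0: "D g0 \<noteq> 0" by blast
  have "Q g = 0" if "D g \<noteq> 0" for g
  proof -
    have g: "g \<in> GL3" using that by (simp add: D_def GL3_iff)
    have nz: "(g ** h) $ 1 $ 1 \<noteq> 0" "minor12 (g ** h) \<noteq> 0" "det (g ** h) \<noteq> 0" if "h \<in> A" for h
      using that \<open>D g \<noteq> 0\<close> A(1) by (auto simp: D_def)
    define dg where "dg h = diag3 (vector [(g ** h) $ 1 $ 1, minor12 (g ** h) / (g ** h) $ 1 $ 1,
      det (g ** h) / minor12 (g ** h)])" for h
    define lower :: "complex \<Rightarrow> complex \<Rightarrow> complex \<Rightarrow> complex^3^3" where
      "lower p q r = vector [vector [1, 0, 0], vector [p, 1, 0], vector [q, r, 1]]" for p q r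
    have "\<forall>h\<in>A. \<exists>p q r. \<exists>u\<in>upper_unitriangular3. g ** h = lower p q r ** (dg h ** u)"
      using big_cell_decomposition nz unfolding dg_def lower_def by blast
    then obtain p q r u where u: "\<And>h. h \<in> A \<Longrightarrow> u h \<in> upper_unitriangular3"
      and gh: "\<And>h. h \<in> A \<Longrightarrow> g ** h = lower (p h) (q h) (r h) ** (dg h ** u h)"
      by metis
    \<comment> \<open>The conjugate of the lower factor by \<open>diag(e^-2, e^-1, 1)\<close>,
      written out so that it is polynomial in \<open>e\<close> and makes sense at
      \<open>e = 0\<close>, where it is the identity.\<close>
    define n where "n e h = lower (e * p h) (e\<^sup>2 * q h) (e * r h)" for e h
    have n_GL3: "n e h \<in> GL3" and det_n: "det (n e h) = 1" for e h
      by (simp_all add: n_def lower_def GL3_iff det_3)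
    have dg_GL3: "dg h \<in> GL3" if "h \<in> A" for h
      using nz[OF that] by (simp add: GL3_iff dg_def det_diag3)
    have poly_n: "\<exists>\<rho>. \<forall>e. P (n e h) = poly \<rho> e" for h
    proof (rule entry_poly_along_curve[OF P])
      fix i j :: 3
      have "\<forall>i j. n e h $ i $ j = poly ((vector [vector [1, 0, 0], vector [[:0, p h:], 1, 0],
          vector [[:0, 0, q h:], [:0, r h:], 1]] :: complex poly^3^3) $ i $ j) e" for e
        by (simp add: n_def lower_def forall_3 power2_eq_square)
      then show "\<exists>\<rho>. \<forall>e. n e h $ i $ j = poly \<rho> e" by blast
    qed
    then obtain \<rho> where \<rho>: "\<And>h e. P (n e h) = poly (\<rho> h) e" by metis
    \<comment> \<open>For \<open>e \<noteq> 0\<close> the value of \<open>R\<close> is, up to a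
      nonzero scalar, the functional applied to the relation translated by \<open>d ** g\<close>. No
      denominators remain because \<open>det (n e h) = 1\<close>.\<close>
    define R where "R = (\<Sum>h\<in>A. smult (c h * flag_monomial a b (g ** h)) (\<rho> h))"
    have "poly R e = 0" if e: "e \<noteq> 0" for e
    proof -
      define d where "d = diag3 (vector [inverse e ^ 2, inverse e, 1])"
      define k where "k = (inverse e ^ 2) ^ (a + b) * inverse e ^ b"
      have dGL3: "d \<in> GL3" using e by (simp add: GL3_iff d_def det_diag3)
      have dv: "act M d v = scal M k v"
        unfolding d_def k_def using e by (subst torus) (simp_all add: forall_3)
      have k: "k \<noteq> 0" using e by (simp add: k_def)
      have *: "act M ((d ** g) ** h) v = scal M (k * flag_monomial a b (g ** h)) (act M (n e h) v)"
        if h: "h \<in> A" for h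
      proof -
        have "d ** lower (p h) (q h) (r h) = n e h ** d"
          using e by (simp add: d_def n_def lower_def vec_eq_iff forall_3 matrix_matrix_mult_def sum_3
              diag3_def power2_eq_square field_simps)
        then have eq: "(d ** g) ** h = n e h ** (d ** (dg h ** u h))"
          using gh[OF h] by (metis matrix_mul_assoc)
        have uG: "u h \<in> GL3" using u[OF h] by (rule upper_unitriangular3_GL3)
        have "act M (dg h) v = scal M (flag_monomial a b (g ** h)) v"
          unfolding dg_def using nz[OF h]
          by (subst torus)
            (simp_all add: forall_3 flag_monomial_def power_add power_divide)
        then show ?thesis
          unfolding eq using u[OF h] uG dGL3 dg_GL3[OF h] n_GL3[of e h] v(1)
          by (simp add: mult GL3_mult closed unip act_scal dv mult.commute)
      qed
      \<comment> \<open>The instance with an empty index set says that the action fixes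
        zero.\<close>
      have "0 = act M (d ** g) (\<Sum>h\<in>A. scal M (c h) (act M h v))"
        using rep_act_sum[OF rep GL3_mult[OF dGL3 g], of "{}"] by (simp add: rel)
      also have "\<dots> = (\<Sum>h\<in>A. scal M (c h) (act M (d ** g) (act M h v)))"
        using A v(1) by (intro rep_act_sum[OF rep GL3_mult[OF dGL3 g]] closed) auto
      also have "\<dots> = (\<Sum>h\<in>A. scal M (c h) (scal M (k * flag_monomial a b (g ** h)) (act M (n e h) v)))"
        using A(2) v(1) dGL3 g by (intro sum.cong) (auto simp: *[symmetric] mult GL3_mult)
      finally have "l (\<Sum>h\<in>A. scal M (c h) (scal M (k * flag_monomial a b (g ** h)) (act M (n e h) v))) = 0"
        by (metis l.zero)
      then have "(\<Sum>h\<in>A. c h * (k * flag_monomial a b (g ** h) * P (n e h))) = 0"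
        by (simp add: l.sum l.scale Pm n_GL3 det_n mult.assoc)
      then have "k * (\<Sum>h\<in>A. c h * flag_monomial a b (g ** h) * P (n e h)) = 0"
        by (simp add: sum_distrib_left algebra_simps)
      then show ?thesis using k by (simp add: R_def poly_sum \<rho>)
    qed
    \<comment> \<open>Vanishing is known only for \<open>e \<noteq> 0\<close>; multiplying by the
      variable covers \<open>e = 0\<close> as well.\<close>
    then have "\<forall>e. poly ([:0, 1:] * R) e = 0" by auto
    then have "[:0, 1:] * R = 0" by (simp only: poly_all_0_iff_0)
    then have R0: "R = 0" by simp
    have "n 0 h = mat 1" for h
      by (simp add: n_def lower_def mat_def vec_eq_iff forall_3)
    then have "poly (\<rho> h) 0 = 1" for h using P1 \<rho>[of 0 h] by simp
    then have "poly R 0 = Q g" by (simp add: R_def Q_def poly_sum)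
    then show ?thesis using R0 by simp
  qed
  then have "Q g = 0" using entry_poly_eq_zero_if_mult[OF D Q g0] by blast
  then show ?thesis by (simp add: Q_def)
qed

abbreviation (input) fscale :: "complex \<Rightarrow> ('a \<Rightarrow> complex) \<Rightarrow> 'a \<Rightarrow> complex" where
  "fscale c f \<equiv> (\<lambda>x. c * f x)"

interpretation fs: vector_space fscale
  by unfold_locales (auto simp: fun_eq_iff algebra_simps)

lemma sum_fun_apply: "sum f A x = (\<Sum>i\<in>A. f i x)"
  for f :: "'i \<Rightarrow> 'a \<Rightarrow> 'b::comm_monoid_add"
  by (induction A rule: infinite_finite_induct) (auto simp: plus_fun_def)

text \<open>The span of the orbit is an invariant subspace containing \<open>v\<close>, so
  irreducibility makes it everything.\<close>

lemma irreducible_orbit_span: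
  assumes irr: "irreducible_representation GL3 M" and v: "v \<in> vecs M" "v \<noteq> 0"
  shows "module.span (scal M) ((\<lambda>h. act M h v) ` GL3) = vecs M"
proof -
  have rep: "representation GL3 M" using irr by (simp add: irreducible_representation_def)
  interpret V: vector_space "scal M" by (rule rep_vector_space[OF rep])
  let ?O = "(\<lambda>h. act M h v) ` GL3"
  have sub: "V.span ?O \<subseteq> vecs M"
    using rep_closed[OF rep] v by (intro V.span_minimal rep_subspace[OF rep]) auto
  have "act M g w \<in> V.span ?O" if g: "g \<in> GL3" and w: "w \<in> V.span ?O" for g w
  proof -
    obtain B r where B: "finite B" "B \<subseteq> ?O" "w = (\<Sum>b\<in>B. scal M (r b) b)"
      using w unfolding V.span_explicit by blast
    have "act M g w = (\<Sum>b\<in>B. scal M (r b) (act M g b))"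
      unfolding B(3) using B rep_closed[OF rep] v by (intro rep_act_sum[OF rep g]) auto
    moreover have "act M g b \<in> V.span ?O" if "b \<in> B" for b
    proof -
      obtain h where "h \<in> GL3" "b = act M h v" using \<open>b \<in> B\<close> B(2) by blast
      then have "act M g b = act M (g ** h) v" using g v by (simp add: rep_mult[OF rep])
      then show ?thesis using GL3_mult[OF g \<open>h \<in> GL3\<close>] by (auto intro: V.span_base)
    qed
    ultimately show ?thesis by (auto intro!: V.span_sum V.span_scale)
  qed
  then have "V.span ?O = {0} \<or> V.span ?O = vecs M"
    using irr sub V.subspace_span unfolding irreducible_representation_def by blast
  moreover have "v \<in> V.span ?O"
  proof -
    have "mat 1 \<in> GL3" by (simp add: GL3_iff)
    moreover have "act M (mat 1) v = v" using rep v by (simp add: representation_def)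
    ultimately show ?thesis by (metis V.span_base imageI)
  qed
  ultimately show ?thesis using v by auto
qed

text \<open>One direction is \<open>flag_monomial_relations\<close>. It yields a linear map from
  \<open>M\<close> to functions sending \<open>act M h v\<close> to the translate of the flag
  monomial by \<open>h\<close>; the kernel is invariant and misses \<open>v\<close>, hence is zero
  by irreducibility, which gives the other direction.\<close>

lemma orbit_relation_iff:
  fixes M :: "(complex^3^3, 'v::ab_group_add) gmodule"
  assumes irr: "irreducible_representation GL3 M" and rat: "rational_representation GL3 M"
    and hw: "highest_weight_vector M (int a *s omega1 + int b *s omega2) v"
    and A: "finite A" "A \<subseteq> GL3"
  shows "(\<Sum>h\<in>A. scal M (c h) (act M h v)) = 0 \<longleftrightarrow>
    (\<forall>g. (\<Sum>h\<in>A. c h * flag_monomial a b (g ** h)) = 0)"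
proof
  have rep: "representation GL3 M" using irr by (simp add: irreducible_representation_def)
  interpret V: vector_space "scal M" by (rule rep_vector_space[OF rep])
  have v: "v \<in> vecs M" "v \<noteq> 0" using hw by (auto simp: highest_weight_vector_def)
  let ?F = "\<lambda>h g. flag_monomial a b (g ** h)"
  have "\<exists>T. Vector_Spaces.linear (scal M) fscale T \<and> (\<forall>h\<in>GL3. T (act M h v) = ?F h)"
    by (rule linear_map_from_relations[OF V.vector_space_axioms fs.vector_space_axioms])
      (simp add: fun_eq_iff sum_fun_apply flag_monomial_relations[OF rat hw])
  then obtain T where T: "Vector_Spaces.linear (scal M) fscale T"
    and Tv: "\<And>h. h \<in> GL3 \<Longrightarrow> T (act M h v) = ?F h"
    by blast
  interpret T: Vector_Spaces.linear "scal M" fscale T by (rule T)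
  note span = irreducible_orbit_span[OF irr v]
  have equiv: "T (act M g w) = (\<lambda>k. T w (k ** g))" if g: "g \<in> GL3" and w: "w \<in> vecs M" for g w
  proof -
    obtain B r where B: "finite B" "B \<subseteq> (\<lambda>h. act M h v) ` GL3" "w = (\<Sum>b\<in>B. scal M (r b) b)"
      using w span unfolding V.span_explicit by blast
    have "act M g w = (\<Sum>b\<in>B. scal M (r b) (act M g b))"
      unfolding B(3) using B rep_closed[OF rep] v by (intro rep_act_sum[OF rep g]) auto
    moreover have "T (act M g b) = (\<lambda>k. T b (k ** g))" if "b \<in> B" for b
    proof -
      obtain h where h: "h \<in> GL3" "b = act M h v" using \<open>b \<in> B\<close> B(2) by blast
      then have "act M g b = act M (g ** h) v" using g v by (simp add: rep_mult[OF rep])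
      then show ?thesis using h g by (simp add: Tv GL3_mult matrix_mul_assoc)
    qed
    ultimately show ?thesis
      by (simp add: B(3) T.sum T.scale fun_eq_iff sum_fun_apply)
  qed
  define K where "K = {w \<in> vecs M. T w = 0}"
  have "V.subspace K"
    using rep_subspace[OF rep] unfolding V.subspace_def K_def
    by (auto simp: T.add T.scale T.zero fun_eq_iff)
  moreover have "act M g w \<in> K" if "g \<in> GL3" "w \<in> K" for g w
    using that rep_closed[OF rep] equiv[of g w] by (auto simp: K_def fun_eq_iff)
  \<comment> \<open>The flag monomial takes the value \<open>1\<close> at the identity.\<close>
  moreover have "v \<notin> K"
  proof -
    have one: "mat 1 \<in> GL3" by (simp add: GL3_iff)
    have "act M (mat 1) v = v" using rep v by (simp add: representation_def)
    then have "T v (mat 1) = flag_monomial a b (mat 1)" using Tv[OF one] by simp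
    also have "\<dots> = 1" by (simp add: flag_monomial_def minor12_def mat_def)
    finally have "T v (mat 1) = 1" .
    then show ?thesis by (auto simp: K_def)
  qed
  ultimately have K: "K = {0}"
    using irr v(1) unfolding irreducible_representation_def by (metis (no_types, lifting) K_def mem_Collect_eq subsetI)
  assume "\<forall>g. (\<Sum>h\<in>A. c h * ?F h g) = 0"
  then have "T (\<Sum>h\<in>A. scal M (c h) (act M h v)) = 0"
    using A(2) by (auto simp: T.sum T.scale fun_eq_iff sum_fun_apply Tv subset_iff intro!: sum.cong[THEN trans])
  moreover have "(\<Sum>h\<in>A. scal M (c h) (act M h v)) \<in> vecs M"
    using A(2) rep_closed[OF rep] v
    by (auto intro!: V.subspace_sum V.subspace_scale rep_subspace[OF rep])
  ultimately show "(\<Sum>h\<in>A. scal M (c h) (act M h v)) = 0" using K by (auto simp: K_def)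
next
  assume "(\<Sum>h\<in>A. scal M (c h) (act M h v)) = 0"
  then show "\<forall>g. (\<Sum>h\<in>A. c h * flag_monomial a b (g ** h)) = 0"
    using flag_monomial_relations[OF rat hw A] by blast
qed

section \<open>Bihomogeneous functions on the cone\<close>

definition col1 :: "complex^3^3 \<Rightarrow> complex^3" where
  "col1 h = (\<chi> i. h $ i $ 1)"

text \<open>The cross product of the first two columns, that is, their Pluecker coordinates.\<close>

definition col12 :: "complex^3^3 \<Rightarrow> complex^3" where
  "col12 h = vector [h$2$1 * h$3$2 - h$3$1 * h$2$2, h$3$1 * h$1$2 - h$1$1 * h$3$2, h$1$1 * h$2$2 - h$2$1 * h$1$2]"

text \<open>Oriented as a rewriting rule that eliminates the product of the two first
  coordinates.\<close>

lemma col1_col12_orthogonal: "col1 h $ 1 * col12 h $ 1 = - col1 h $ 2 * col12 h $ 2 - col1 h $ 3 * col12 h $ 3"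
  by (simp add: col1_def col12_def algebra_simps)

text \<open>Polynomials in \<open>col1 h\<close> and \<open>col12 h\<close>, taken as functions of
  \<open>h\<close>, so that polynomials agreeing on the cone are identified from the start.\<close>

inductive bihom :: "nat \<Rightarrow> nat \<Rightarrow> (complex^3^3 \<Rightarrow> complex) \<Rightarrow> bool" where
  one: "bihom 0 0 (\<lambda>h. 1)"
| zero: "bihom p q (\<lambda>h. 0)"
| add: "bihom p q F \<Longrightarrow> bihom p q G \<Longrightarrow> bihom p q (\<lambda>h. F h + G h)"
| scale: "bihom p q F \<Longrightarrow> bihom p q (\<lambda>h. c * F h)"
| col1: "bihom p q F \<Longrightarrow> bihom (Suc p) q (\<lambda>h. col1 h $ i * F h)"
| col12: "bihom p q F \<Longrightarrow> bihom p (Suc q) (\<lambda>h. col12 h $ i * F h)"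

lemma bihom_mult:
  assumes "bihom p q F" and G: "bihom p' q' G"
  shows "bihom (p + p') (q + q') (\<lambda>h. F h * G h)"
  using assms(1)
proof induction
  case one
  then show ?case using G by simp
next
  case (zero p q)
  then show ?case by (simp add: bihom.zero)
next
  case (add p q F G)
  then show ?case by (simp add: bihom.add distrib_right)
next
  case (scale p q F c)
  then show ?case using bihom.scale[OF scale.IH, of c] by (simp add: mult.assoc)
next
  case (col1 p q F i)
  then show ?case using bihom.col1[OF col1.IH, of i] by (simp add: mult.assoc)
next
  case (col12 p q F i)
  then show ?case using bihom.col12[OF col12.IH, of i] by (simp add: mult.assoc)
qed

lemma bihom_power: "bihom p q F \<Longrightarrow> bihom (n * p) (n * q) (\<lambda>h. F h ^ n)"
proof (induction n)
  case 0
  then show ?case by (simp add: bihom.one)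
next
  case (Suc n)
  then show ?case using bihom_mult[of p q F] by simp
qed

lemma bihom_sum:
  "finite A \<Longrightarrow> (\<And>x. x \<in> A \<Longrightarrow> bihom p q (F x)) \<Longrightarrow> bihom p q (\<lambda>h. \<Sum>x\<in>A. F x h)"
  by (induction A rule: finite_induct) (auto intro: bihom.intros)

lemma bihom_diff: "bihom p q F \<Longrightarrow> bihom p q G \<Longrightarrow> bihom p q (\<lambda>h. F h - G h)"
  using bihom.add[OF _ bihom.scale, of p q F G "-1"] by simp

lemma bihom_col1_nth: "bihom 1 0 (\<lambda>h. col1 h $ i)"
  using bihom.col1[OF bihom.one, of i] by simp

lemma bihom_col12_nth: "bihom 0 1 (\<lambda>h. col12 h $ i)"
  using bihom.col12[OF bihom.one, of i] by simp

definition row12 :: "complex^3^3 \<Rightarrow> complex^3" where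
  "row12 g = col12 (transpose g)"

text \<open>The second pairing is the Cauchy-Binet formula for the leading 2 by 2 minor.\<close>

lemma flag_monomial_mult:
  "flag_monomial a b (g ** h) =
    (\<Sum>i\<in>UNIV. g $ 1 $ i * col1 h $ i) ^ a * (\<Sum>i\<in>UNIV. row12 g $ i * col12 h $ i) ^ b"
proof -
  have "minor12 (g ** h) = (\<Sum>i\<in>UNIV. row12 g $ i * col12 h $ i)"
    by (simp add: minor12_def matrix_matrix_mult_def sum_3 row12_def col12_def transpose_def algebra_simps)
  then show ?thesis
    by (simp add: flag_monomial_def matrix_matrix_mult_def col1_def)
qed

lemma bihom_flag_monomial: "bihom a b (\<lambda>h. flag_monomial a b (g ** h))"
proof -
  have 1: "bihom 1 0 (\<lambda>h. \<Sum>i\<in>UNIV. g $ 1 $ i * col1 h $ i)"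
    by (intro bihom_sum bihom.scale bihom_col1_nth) simp
  have 2: "bihom 0 1 (\<lambda>h. \<Sum>i\<in>UNIV. row12 g $ i * col12 h $ i)"
    by (intro bihom_sum bihom.scale bihom_col12_nth) simp
  show ?thesis
    unfolding flag_monomial_mult
    using bihom_mult[OF bihom_power[OF 1, of a] bihom_power[OF 2, of b]] by simp
qed

section \<open>Normal forms modulo the orthogonality relation\<close>

definition monomial3 :: "nat \<Rightarrow> nat \<Rightarrow> nat \<Rightarrow> complex^3 \<Rightarrow> complex" where
  "monomial3 i j k x = x $ 1 ^ i * x $ 2 ^ j * x $ 3 ^ k"

text \<open>Normal forms: the monomials not divisible by the product of the two first
  coordinates.\<close>

definition reduced_monomials :: "nat \<Rightarrow> nat \<Rightarrow> (complex^3^3 \<Rightarrow> complex) set" where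
  "reduced_monomials a b = {(\<lambda>h. monomial3 i j k (col1 h) * monomial3 i' j' k' (col12 h)) | i j k i' j' k'.
     i + j + k = a \<and> i' + j' + k' = b \<and> (i = 0 \<or> i' = 0)}"

lemma reduced_monomialsI:
  assumes "i + j + k = a" "i' + j' + k' = b" "i = 0 \<or> i' = 0"
    "F = (\<lambda>h. monomial3 i j k (col1 h) * monomial3 i' j' k' (col12 h))"
  shows "F \<in> fs.span (reduced_monomials a b)"
  using assms unfolding reduced_monomials_def by (intro fs.span_base) blast

lemma fs_span_mult:
  assumes "F \<in> fs.span S" "\<And>m. m \<in> S \<Longrightarrow> (\<lambda>h. G h * m h) \<in> fs.span S'"
  shows "(\<lambda>h. G h * F h) \<in> fs.span S'"
  using assms(1)
proof (induction rule: fs.span_induct_alt)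
  case base
  show ?case using fs.span_zero[of S'] by (simp add: zero_fun_def)
next
  case (step c x y)
  then show ?case
    using fs.span_add[OF fs.span_scale[OF assms(2)[of x], of c] step(2)]
    by (simp add: plus_fun_def algebra_simps)
qed

text \<open>Multiplying a reduced monomial by a first coordinate may create the forbidden product,
  which orthogonality replaces. The exponent of that coordinate was zero before, so one replacement
  leaves only reduced monomials.\<close>

lemma bihom_in_span:
  assumes "bihom p q F"
  shows "F \<in> fs.span (reduced_monomials p q)"
  using assms
proof induction
  case one
  then show ?case by (rule reduced_monomialsI[of 0 0 0 _ 0 0 0]) (auto simp: monomial3_def)
next
  case (zero p q)
  then show ?case using fs.span_zero by (simp add: zero_fun_def)
next
  case (add p q F G)
  then show ?case using fs.span_add by (force simp: plus_fun_def)
next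
  case (scale p q F c)
  then show ?case by (simp add: fs.span_scale)
next
  case (col1 p q F l)
  show ?case
  proof (rule fs_span_mult[OF col1.IH])
    fix m assume "m \<in> reduced_monomials p q"
    then obtain i j k i' j' k' where *: "i + j + k = p" "i' + j' + k' = q" "i = 0 \<or> i' = 0"
      and m: "m = (\<lambda>h. monomial3 i j k (col1 h) * monomial3 i' j' k' (col12 h))"
      unfolding reduced_monomials_def by blast
    consider "l = 1" "i' = 0" | n where "l = 1" "i' = Suc n" "i = 0" | "l = 2" | "l = 3"
      using exhaust_3[of l] *(3) by (cases i') auto
    then show "(\<lambda>h. col1 h $ l * m h) \<in> fs.span (reduced_monomials (Suc p) q)"
    proof cases
      case 1
      then show ?thesis using *
        by (intro reduced_monomialsI[of "Suc i" j k _ i' j' k']) (auto simp: m monomial3_def)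
    next
      case 2
      have "(\<lambda>h. monomial3 0 (Suc j) k (col1 h) * monomial3 n (Suc j') k' (col12 h)) \<in> fs.span (reduced_monomials (Suc p) q)"
        using * 2 by (intro reduced_monomialsI[of 0 "Suc j" k _ n "Suc j'" k']) auto
      moreover have "(\<lambda>h. monomial3 0 j (Suc k) (col1 h) * monomial3 n j' (Suc k') (col12 h)) \<in> fs.span (reduced_monomials (Suc p) q)"
        using * 2 by (intro reduced_monomialsI[of 0 j "Suc k" _ n j' "Suc k'"]) auto
      ultimately have "(\<lambda>h. - (monomial3 0 (Suc j) k (col1 h) * monomial3 n (Suc j') k' (col12 h))
          - monomial3 0 j (Suc k) (col1 h) * monomial3 n j' (Suc k') (col12 h)) \<in> fs.span (reduced_monomials (Suc p) q)"
        using fs.span_diff[OF fs.span_neg] by (simp add: fun_diff_def fun_Compl_def)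
      moreover have "col1 h $ l * m h = - (monomial3 0 (Suc j) k (col1 h) * monomial3 n (Suc j') k' (col12 h))
          - monomial3 0 j (Suc k) (col1 h) * monomial3 n j' (Suc k') (col12 h)" for h
      proof -
        have "col1 h $ l * m h = (col1 h $ 1 * col12 h $ 1) * (monomial3 0 j k (col1 h) * monomial3 n j' k' (col12 h))"
          using 2 by (simp add: m monomial3_def)
        then show ?thesis unfolding col1_col12_orthogonal by (simp add: monomial3_def algebra_simps)
      qed
      ultimately show ?thesis by simp
    next
      case 3
      then show ?thesis using *
        by (intro reduced_monomialsI[of i "Suc j" k _ i' j' k']) (auto simp: m monomial3_def)
    next
      case 4
      then show ?thesis using *
        by (intro reduced_monomialsI[of i j "Suc k" _ i' j' k']) (auto simp: m monomial3_def)
    qed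
  qed
next
  case (col12 p q F l)
  show ?case
  proof (rule fs_span_mult[OF col12.IH])
    fix m assume "m \<in> reduced_monomials p q"
    then obtain i j k i' j' k' where *: "i + j + k = p" "i' + j' + k' = q" "i = 0 \<or> i' = 0"
      and m: "m = (\<lambda>h. monomial3 i j k (col1 h) * monomial3 i' j' k' (col12 h))"
      unfolding reduced_monomials_def by blast
    consider "l = 1" "i = 0" | n where "l = 1" "i = Suc n" "i' = 0" | "l = 2" | "l = 3"
      using exhaust_3[of l] *(3) by (cases i) auto
    then show "(\<lambda>h. col12 h $ l * m h) \<in> fs.span (reduced_monomials p (Suc q))"
    proof cases
      case 1
      then show ?thesis using *
        by (intro reduced_monomialsI[of i j k _ "Suc i'" j' k']) (auto simp: m monomial3_def)
    next
      case 2
      have "(\<lambda>h. monomial3 n (Suc j) k (col1 h) * monomial3 0 (Suc j') k' (col12 h)) \<in> fs.span (reduced_monomials p (Suc q))"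
        using * 2 by (intro reduced_monomialsI[of n "Suc j" k _ 0 "Suc j'" k']) auto
      moreover have "(\<lambda>h. monomial3 n j (Suc k) (col1 h) * monomial3 0 j' (Suc k') (col12 h)) \<in> fs.span (reduced_monomials p (Suc q))"
        using * 2 by (intro reduced_monomialsI[of n j "Suc k" _ 0 j' "Suc k'"]) auto
      ultimately have "(\<lambda>h. - (monomial3 n (Suc j) k (col1 h) * monomial3 0 (Suc j') k' (col12 h))
          - monomial3 n j (Suc k) (col1 h) * monomial3 0 j' (Suc k') (col12 h)) \<in> fs.span (reduced_monomials p (Suc q))"
        using fs.span_diff[OF fs.span_neg] by (simp add: fun_diff_def fun_Compl_def)
      moreover have "col12 h $ l * m h = - (monomial3 n (Suc j) k (col1 h) * monomial3 0 (Suc j') k' (col12 h))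
          - monomial3 n j (Suc k) (col1 h) * monomial3 0 j' (Suc k') (col12 h)" for h
      proof -
        have "col12 h $ l * m h = (col1 h $ 1 * col12 h $ 1) * (monomial3 n j k (col1 h) * monomial3 0 j' k' (col12 h))"
          using 2 by (simp add: m monomial3_def)
        then show ?thesis unfolding col1_col12_orthogonal by (simp add: monomial3_def algebra_simps)
      qed
      ultimately show ?thesis by simp
    next
      case 3
      then show ?thesis using *
        by (intro reduced_monomialsI[of i j k _ i' "Suc j'" k']) (auto simp: m monomial3_def)
    next
      case 4
      then show ?thesis using *
        by (intro reduced_monomialsI[of i j k _ i' j' "Suc k'"]) (auto simp: m monomial3_def)
    qed
  qed
qed

section \<open>Positivity and relations between monomials\<close>

definition trinomial_index :: "nat \<Rightarrow> (nat \<times> nat) set" where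
  "trinomial_index a = Sigma {..a} (\<lambda>m. {..m})"

definition trinomial_coeff :: "nat \<Rightarrow> nat \<times> nat \<Rightarrow> nat" where
  "trinomial_coeff a = (\<lambda>(m, i). (a choose m) * (m choose i))"

definition trinomial_term :: "nat \<Rightarrow> nat \<times> nat \<Rightarrow> complex^3 \<Rightarrow> complex" where
  "trinomial_term a = (\<lambda>(m, i). monomial3 i (m - i) (a - m))"

lemma finite_trinomial_index: "finite (trinomial_index a)"
  by (simp add: trinomial_index_def)

text \<open>The binomial theorem applied twice, whence the index \<open>(m, i)\<close> for the
  exponents \<open>i\<close>, \<open>m - i\<close> and \<open>a - m\<close>.\<close>

lemma trinomial_expansion:
  fixes u x :: "complex^3"
  shows "(\<Sum>i\<in>UNIV. u $ i * x $ i) ^ a =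
    (\<Sum>m\<in>trinomial_index a. of_nat (trinomial_coeff a m) * trinomial_term a m u * trinomial_term a m x)"
proof -
  have "(\<Sum>i\<in>UNIV. u $ i * x $ i) ^ a = ((u$1 * x$1 + u$2 * x$2) + u$3 * x$3) ^ a"
    by (simp add: sum_3)
  also have "\<dots> = (\<Sum>m\<le>a. \<Sum>i\<le>m. of_nat (a choose m) * of_nat (m choose i)
      * (u$1 * x$1) ^ i * (u$2 * x$2) ^ (m - i) * (u$3 * x$3) ^ (a - m))"
    unfolding binomial_ring[of "u$1 * x$1 + u$2 * x$2"] binomial_ring[of "u$1 * x$1"]
    by (simp add: sum_distrib_left sum_distrib_right algebra_simps)
  also have "\<dots> = (\<Sum>m\<in>trinomial_index a. of_nat (trinomial_coeff a m) * trinomial_term a m u * trinomial_term a m x)"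
    unfolding trinomial_index_def
    by (subst sum.Sigma) (auto simp: trinomial_coeff_def trinomial_term_def monomial3_def
        power_mult_distrib intro!: sum.cong)
  finally show ?thesis .
qed

lemma trinomial_term_cnj: "trinomial_term a m (\<chi> i. cnj (x $ i)) = cnj (trinomial_term a m x)"
  by (simp add: trinomial_term_def monomial3_def split: prod.split)

text \<open>Evaluating at the conjugate transposes of the \<open>h\<close> turns the hypothesis into the vanishing of a
  positive definite Hermitian form in the numbers \<open>E\<close>.\<close>

lemma trinomial_relations:
  assumes A: "finite A" and rel: "\<And>g. (\<Sum>h\<in>A. c h * flag_monomial a b (g ** h)) = 0"
    and m: "m \<in> trinomial_index a" and n: "n \<in> trinomial_index b"
  shows "(\<Sum>h\<in>A. c h * (trinomial_term a m (col1 h) * trinomial_term b n (col12 h))) = 0"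
proof -
  define E where "E m n = (\<Sum>h\<in>A. c h * (trinomial_term a m (col1 h) * trinomial_term b n (col12 h)))" for m n
  define w where "w m n = real (trinomial_coeff a m) * real (trinomial_coeff b n)" for m n
  define ct where "ct h = (\<chi> i j. cnj (h $ j $ i))" for h :: "complex^3^3"
  have ct1: "ct k $ 1 = (\<chi> i. cnj (col1 k $ i))" and ct2: "row12 (ct k) = (\<chi> i. cnj (col12 k $ i))" for k
    by (simp_all add: ct_def col1_def row12_def col12_def transpose_def vec_eq_iff forall_3)
  have flag: "flag_monomial a b (ct k ** h) = (\<Sum>m\<in>trinomial_index a. \<Sum>n\<in>trinomial_index b. of_real (w m n) *
      cnj (trinomial_term a m (col1 k) * trinomial_term b n (col12 k)) * (trinomial_term a m (col1 h) * trinomial_term b n (col12 h)))"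
    for k h
    unfolding flag_monomial_mult trinomial_expansion sum_product ct1 ct2 trinomial_term_cnj
    by (simp add: w_def mult_ac)
  have "0 = (\<Sum>k\<in>A. cnj (c k) * (\<Sum>h\<in>A. c h * flag_monomial a b (ct k ** h)))"
    by (simp add: rel)
  also have "\<dots> = (\<Sum>k\<in>A. \<Sum>h\<in>A. \<Sum>m\<in>trinomial_index a. \<Sum>n\<in>trinomial_index b. of_real (w m n) *
      (cnj (c k * (trinomial_term a m (col1 k) * trinomial_term b n (col12 k))) *
       (c h * (trinomial_term a m (col1 h) * trinomial_term b n (col12 h)))))"
    unfolding flag by (simp add: sum_distrib_left mult_ac)
  also have "\<dots> = (\<Sum>m\<in>trinomial_index a. \<Sum>n\<in>trinomial_index b. \<Sum>k\<in>A. \<Sum>h\<in>A. of_real (w m n) *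
      (cnj (c k * (trinomial_term a m (col1 k) * trinomial_term b n (col12 k))) *
       (c h * (trinomial_term a m (col1 h) * trinomial_term b n (col12 h)))))"
    \<comment> \<open>The swaps move the two sums over matrices inside, so that they factor into
      \<open>cnj (E m n) * E m n\<close>.\<close>
    apply (subst (2) sum.swap)
    apply (subst (1) sum.swap)
    apply (subst (3) sum.swap)
    apply (subst (2) sum.swap)
    apply (rule refl)
    done
  also have "\<dots> = (\<Sum>m\<in>trinomial_index a. \<Sum>n\<in>trinomial_index b. of_real (w m n) * (cnj (E m n) * E m n))"
    unfolding E_def cnj_sum sum_product by (simp only: sum_distrib_left complex_cnj_mult)
  also have "\<dots> = of_real (\<Sum>m\<in>trinomial_index a. \<Sum>n\<in>trinomial_index b. w m n * (cmod (E m n))\<^sup>2)"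
    by (simp add: complex_norm_square mult.commute del: of_real_power)
  finally have "of_real (\<Sum>m\<in>trinomial_index a. \<Sum>n\<in>trinomial_index b. w m n * (cmod (E m n))\<^sup>2) = (0::complex)"
    by (rule sym)
  then have "(\<Sum>m\<in>trinomial_index a. \<Sum>n\<in>trinomial_index b. w m n * (cmod (E m n))\<^sup>2) = 0"
    by (simp only: of_real_eq_0_iff)
  moreover have "w m n * (cmod (E m n))\<^sup>2 \<ge> 0" for m n by (simp add: w_def)
  ultimately have "w m n * (cmod (E m n))\<^sup>2 = 0"
    using m n by (simp add: sum_nonneg_eq_0_iff finite_trinomial_index sum_nonneg)
  \<comment> \<open>The weights are products of multinomial coefficients, so the form is definite
    and not only semidefinite.\<close>
  moreover have "w m n > 0"
    using m n by (auto simp: w_def trinomial_index_def trinomial_coeff_def)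
  ultimately show ?thesis by (simp add: E_def)
qed

text \<open>The reduced monomials span, and each is a product of two trinomial terms, to which
  \<open>trinomial_relations\<close> applies.\<close>

lemma bihom_relations:
  assumes A: "finite A" and rel: "\<And>g. (\<Sum>h\<in>A. c h * flag_monomial a b (g ** h)) = 0"
    and F: "bihom a b F"
  shows "(\<Sum>h\<in>A. c h * F h) = 0"
proof -
  have "F \<in> fs.span (reduced_monomials a b)" by (rule bihom_in_span[OF F])
  then show ?thesis
  proof (induction rule: fs.span_induct_alt)
    case base
    then show ?case by simp
  next
    case (step r x y)
    obtain i j k i' j' k' where *: "i + j + k = a" "i' + j' + k' = b"
      and x: "x = (\<lambda>h. monomial3 i j k (col1 h) * monomial3 i' j' k' (col12 h))"
      using step(1) unfolding reduced_monomials_def by blast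
    have "x = (\<lambda>h. trinomial_term a (i + j, i) (col1 h) * trinomial_term b (i' + j', i') (col12 h))"
      using * by (auto simp: x trinomial_term_def)
    moreover have "(i + j, i) \<in> trinomial_index a" "(i' + j', i') \<in> trinomial_index b"
      using * by (auto simp: trinomial_index_def)
    ultimately have "(\<Sum>h\<in>A. c h * x h) = 0" using trinomial_relations[OF A rel] by simp
    then have "r * (\<Sum>h\<in>A. c h * x h) + (\<Sum>h\<in>A. c h * y h) = 0" using step(2) by simp
    then show ?case by (simp add: plus_fun_def sum_distrib_left sum.distrib algebra_simps)
  qed
qed

section \<open>Counting reduced monomials\<close>

lemma card_pairs_le: "card {(i, j). i + j \<le> (n::nat)} * 2 = (n + 1) * (n + 2)"
proof -
  have "{(i, j). i + j \<le> n} = Sigma {..n} (\<lambda>i. {..n - i})" by auto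
  then have "card {(i, j). i + j \<le> n} = (\<Sum>i\<le>n. Suc (n - i))" by simp
  also have "\<dots> = (\<Sum>i\<le>n. Suc i)"
    by (rule sum.nat_diff_reindex[of "\<lambda>i. Suc i" "Suc n", unfolded lessThan_Suc_atMost, simplified])
  also have "\<dots> * 2 = (n + 1) * (n + 2)" by (induction n) auto
  finally show ?thesis .
qed

lemma finite_pairs_le: "finite {(i, j). i + j \<le> (n::nat)}"
  by (rule finite_subset[of _ "{..n} \<times> {..n}"]) auto

text \<open>The bound is the dimension given by Weyl's formula. An upper bound is enough: the
  independent coefficients of the covariants will turn out to attain it.\<close>

lemma card_reduced_monomials:
  "finite (reduced_monomials a b)"
  "card (reduced_monomials a b) * 2 \<le> (a + 1) * (b + 1) * (a + b + 2)"
proof -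
  define P where "P n = {(i, j). i + j \<le> (n::nat)}" for n
  define f where "f = (\<lambda>((i, j), (i', j')) h. monomial3 i j (a - i - j) (col1 h) * monomial3 i' j' (b - i' - j') (col12 h))"
  \<comment> \<open>Either the first exponent of \<open>col1 h\<close> is zero, or it is positive
    and then the first exponent of \<open>col12 h\<close> is zero.\<close>
  have sub: "reduced_monomials a b \<subseteq> (\<lambda>(j, q). f ((0, j), q)) ` ({..a} \<times> P b)
      \<union> (\<lambda>((i, j), j'). f ((Suc i, j), (0, j'))) ` ({(i, j). i + j < a} \<times> {..b})" (is "_ \<subseteq> ?U")
  proof
    fix F assume "F \<in> reduced_monomials a b"
    then obtain i j k i' j' k' where *: "i + j + k = a" "i' + j' + k' = b" "i = 0 \<or> i' = 0"
      and F: "F = (\<lambda>h. monomial3 i j k (col1 h) * monomial3 i' j' k' (col12 h))"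
      unfolding reduced_monomials_def by blast
    have Ff: "F = f ((i, j), (i', j'))" using * by (auto simp: F f_def)
    show "F \<in> ?U"
    proof (cases i)
      case 0
      then have "F = (\<lambda>(j, q). f ((0, j), q)) (j, (i', j'))" "(j, (i', j')) \<in> {..a} \<times> P b"
        using * Ff by (auto simp: P_def)
      then show ?thesis by blast
    next
      case (Suc n)
      then have "F = (\<lambda>((i, j), j'). f ((Suc i, j), (0, j'))) ((n, j), j')" "((n, j), j') \<in> {(i, j). i + j < a} \<times> {..b}"
        using * Ff by auto
      then show ?thesis by blast
    qed
  qed
  have lt: "finite {(i, j). i + j < a}" "card {(i, j). i + j < a} * 2 = a * (a + 1)"
    using finite_pairs_le[of "a - 1"] card_pairs_le[of "a - 1"]
    by (cases a; simp add: less_Suc_eq_le)+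
  have fin: "finite ({..a} \<times> P b)" "finite ({(i, j). i + j < a} \<times> {..b})"
    using lt(1) finite_pairs_le by (auto simp: P_def)
  show "finite (reduced_monomials a b)" using finite_subset[OF sub] fin by blast
  have "card (reduced_monomials a b) \<le> card ?U" using fin by (intro card_mono sub) blast
  also have "\<dots> \<le> card ({..a} \<times> P b) + card ({(i, j). i + j < a} \<times> {..b})"
    by (rule order_trans[OF card_Un_le add_mono[OF card_image_le[OF fin(1)] card_image_le[OF fin(2)]]])
  also have "\<dots> = (a + 1) * card (P b) + card {(i, j). i + j < a} * (b + 1)"
    by (simp add: card_cartesian_product)
  finally have "card (reduced_monomials a b) * 2 \<le> (a + 1) * (card (P b) * 2) + (card {(i, j). i + j < a} * 2) * (b + 1)"
    by (simp add: algebra_simps)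
  also have "\<dots> = (a + 1) * (b + 1) * (a + b + 2)"
    unfolding lt(2) P_def card_pairs_le by (simp add: algebra_simps)
  finally show "card (reduced_monomials a b) * 2 \<le> (a + 1) * (b + 1) * (a + b + 2)" .
qed

section \<open>Covariants of two binary quadratic forms\<close>

definition disc :: "complex^3 \<Rightarrow> complex" where
  "disc c = (c $ 2)\<^sup>2 - 4 * c $ 1 * c $ 3"

text \<open>The coefficients of half the Jacobian determinant \<open>F_x G_y - F_y G_x\<close> of
  the two forms.\<close>

definition jac :: "complex^3 \<Rightarrow> complex^3 \<Rightarrow> complex^3" where
  "jac c d = vector [c$1 * d$2 - c$2 * d$1, 2 * (c$1 * d$3 - c$3 * d$1), c$2 * d$3 - c$3 * d$2]"

text \<open>The isomorphism of \<open>Sym\<^sup>2\<close> with its dual given by the discriminant form.\<close>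

definition dual_form :: "complex^3 \<Rightarrow> complex^3" where
  "dual_form y = vector [y$3, - 2 * y$2, y$1]"

lemma quadratic_form_sym2: "quadratic_form (sym2 g *v c) z = quadratic_form c (z v* g)"
  using act_Sym_2[of g c] by (simp add: Sym_def fun_eq_iff)

lemma disc_sym2: "disc (sym2 g *v c) = det g ^ 2 * disc c"
  by (simp add: disc_def sym2_def matrix_vector_mult_def sum_3 det_2 power2_eq_square algebra_simps)

lemma jac_sym2: "jac (sym2 g *v c) (sym2 g *v d) = det g *s (sym2 g *v jac c d)"
  by (simp add: vec_eq_iff forall_3 jac_def sym2_def matrix_vector_mult_def sum_3 det_2
      power2_eq_square algebra_simps)

lemma col1_mult: "col1 (g ** h) = g *v col1 h"
  by (simp add: col1_def matrix_vector_mult_def matrix_matrix_mult_def vec_eq_iff)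

text \<open>The cross product transforms by the cofactor matrix of \<open>sym2 g\<close>. As
  \<open>sym2 g\<close> preserves the discriminant form up to \<open>det g ^ 2\<close>,
  \<open>dual_form\<close> turns this into \<open>sym2 g\<close> itself, up to the factor
  \<open>det g\<close>.\<close>

lemma dual_form_col12_sym2:
  "dual_form (col12 (sym2 g ** h)) = det g *s (sym2 g *v dual_form (col12 h))"
  by (simp add: vec_eq_iff forall_3 dual_form_def col12_def sym2_def matrix_vector_mult_def
      matrix_matrix_mult_def sum_3 det_2 power2_eq_square algebra_simps)

section \<open>Univariate polynomials as binary forms\<close>

definition homogenize :: "nat \<Rightarrow> complex poly \<Rightarrow> complex^2 \<Rightarrow> complex" where
  "homogenize n p = (\<lambda>z. \<Sum>i\<le>n. coeff p i * (z $ 1) ^ (n - i) * (z $ 2) ^ i)"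

lemma homogenize_in_Sym: "homogenize n p \<in> vecs (Sym n)"
  by (auto simp: Sym_def homogenize_def)

lemma homogenize_poly:
  assumes "degree p \<le> n" "z $ 1 \<noteq> 0"
  shows "homogenize n p z = (z $ 1) ^ n * poly p (z $ 2 / z $ 1)"
proof -
  have "poly p (z $ 2 / z $ 1) = (\<Sum>i\<le>n. coeff p i * (z $ 2 / z $ 1) ^ i)"
    using assms(1) by (simp add: poly_altdef) (intro sum.mono_neutral_left; auto simp: coeff_eq_0)
  then have "(z $ 1) ^ n * poly p (z $ 2 / z $ 1) = (\<Sum>i\<le>n. (z $ 1) ^ n * (coeff p i * (z $ 2 / z $ 1) ^ i))"
    by (simp add: sum_distrib_left)
  also have "\<dots> = (\<Sum>i\<le>n. coeff p i * (z $ 1) ^ (n - i) * (z $ 2) ^ i)"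
    using assms(2) by (intro sum.cong refl) (simp add: power_divide power_diff)
  finally show ?thesis by (simp add: homogenize_def)
qed

lemma homogenize_at_infinity: "z $ 1 = 0 \<Longrightarrow> homogenize n p z = coeff p n * (z $ 2) ^ n"
proof -
  assume "z $ 1 = 0"
  then have "homogenize n p z = (\<Sum>i\<le>n. if i = n then coeff p i * (z $ 2) ^ i else 0)"
    unfolding homogenize_def by (intro sum.cong) auto
  then show ?thesis by simp
qed

lemma coeff_mult_top:
  fixes p q :: "'a::comm_semiring_1 poly"
  assumes "degree p \<le> m" "degree q \<le> n"
  shows "coeff (p * q) (m + n) = coeff p m * coeff q n"
proof -
  have "coeff (p * q) (m + n) = (\<Sum>i\<le>m + n. if i = m then coeff p m * coeff q n else 0)"
    unfolding coeff_mult using assms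
    by (intro sum.cong refl) (auto simp: coeff_eq_0 not_less elim!: linorder_neqE_nat)
  then show ?thesis by simp
qed

text \<open>Where \<open>z $ 1 \<noteq> 0\<close> this is evaluation at
  \<open>z $ 2 / z $ 1\<close>; where \<open>z $ 1 = 0\<close> only the coefficients in the nominal
  top degrees survive, and these multiply.\<close>

lemma homogenize_mult:
  assumes "degree p \<le> m" "degree q \<le> n"
  shows "homogenize (m + n) (p * q) z = homogenize m p z * homogenize n q z"
proof (cases "z $ 1 = 0")
  case True
  then show ?thesis by (simp add: homogenize_at_infinity coeff_mult_top[OF assms] power_add)
next
  case False
  have "degree (p * q) \<le> m + n" using degree_mult_le[of p q] assms by linarith
  then show ?thesis using False assms by (simp add: homogenize_poly power_add)
qed

lemma homogenize_power:
  assumes "degree p \<le> m"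
  shows "homogenize (m * k) (p ^ k) z = homogenize m p z ^ k"
proof (induction k)
  case 0
  show ?case by (simp add: homogenize_def)
next
  case (Suc k)
  have "degree (p ^ k) \<le> m * k" using degree_power_le[of p k] assms by (meson le_trans mult_le_mono1)
  then show ?case using homogenize_mult[OF assms] Suc.IH by simp
qed

lemma homogenize_smult: "homogenize n (smult c p) z = c * homogenize n p z"
  by (simp add: homogenize_def sum_distrib_left mult.assoc)

definition qpoly :: "complex^3 \<Rightarrow> complex poly" where
  "qpoly c = [:c$1, c$2, c$3:]"

lemma degree_qpoly: "degree (qpoly c) \<le> 2"
  by (simp add: qpoly_def)

lemma homogenize_qpoly: "homogenize 2 (qpoly c) = quadratic_form c"
  by (simp add: homogenize_def qpoly_def quadratic_form_def numeral_2_eq_2 fun_eq_iff algebra_simps)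

section \<open>The covariants and their equivariance\<close>

definition cov_index :: "nat \<Rightarrow> nat \<Rightarrow> (nat \<times> nat \<times> nat) set" where
  "cov_index a b = {(e, k, l). e \<le> 1 \<and> 2 * k + e \<le> a \<and> 2 * l + e \<le> b}"

definition cov_order :: "nat \<Rightarrow> nat \<Rightarrow> nat \<times> nat \<times> nat \<Rightarrow> nat" where
  "cov_order a b = (\<lambda>(e, k, l). 2 * (a + b - 2 * k - 2 * l - e))"

text \<open>On the cone \<open>J^2 = disc F * G^2 + disc G * F^2\<close>, which is why powers of the
  Jacobian above the first do not occur.\<close>

definition cov :: "nat \<Rightarrow> nat \<Rightarrow> nat \<times> nat \<times> nat \<Rightarrow> complex^3^3 \<Rightarrow> complex poly" where
  "cov a b = (\<lambda>(e, k, l) h. let F = col1 h; G = dual_form (col12 h) in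
     smult (disc F ^ k * disc G ^ l)
       (qpoly F ^ (a - 2 * k - e) * qpoly G ^ (b - 2 * l - e) * qpoly (jac F G) ^ e))"

lemma finite_cov_index: "finite (cov_index a b)"
  by (rule finite_subset[of _ "{..1} \<times> {..a} \<times> {..b}"]) (auto simp: cov_index_def)

lemma degree_qpoly_power: "degree (qpoly c ^ k) \<le> 2 * k"
  using degree_power_le[of "qpoly c" k] degree_qpoly[of c] by (meson le_trans mult_le_mono1)

lemma cov_order_eq:
  "(e, k, l) \<in> cov_index a b \<Longrightarrow> cov_order a b (e, k, l) = 2 * (a - 2 * k - e) + 2 * (b - 2 * l - e) + 2 * e"
  by (auto simp: cov_index_def cov_order_def)

lemma degree_cov:
  assumes "x \<in> cov_index a b"
  shows "degree (cov a b x h) \<le> cov_order a b x"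
proof -
  obtain e k l where x: "x = (e, k, l)" by (cases x)
  have *: "degree (p * q) \<le> m + n" if "degree p \<le> m" "degree q \<le> n" for p q :: "complex poly" and m n
    using degree_mult_le[of p q] that by linarith
  show ?thesis
    using assms unfolding x cov_def Let_def
    by (auto simp: cov_order_eq intro!: order_trans[OF degree_smult_le] * degree_qpoly_power)
qed

lemma homogenize_cov:
  assumes "(e, k, l) \<in> cov_index a b"
  shows "homogenize (cov_order a b (e, k, l)) (cov a b (e, k, l) h) z =
    disc (col1 h) ^ k * disc (dual_form (col12 h)) ^ l * (quadratic_form (col1 h) z ^ (a - 2 * k - e)
      * quadratic_form (dual_form (col12 h)) z ^ (b - 2 * l - e)
      * quadratic_form (jac (col1 h) (dual_form (col12 h))) z ^ e)"
proof -
  have "degree (qpoly c ^ m * qpoly d ^ n) \<le> 2 * m + 2 * n" for c d m n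
    using degree_mult_le[of "qpoly c ^ m" "qpoly d ^ n"] degree_qpoly_power[of c m] degree_qpoly_power[of d n]
    by linarith
  then show ?thesis
    by (simp add: cov_order_eq[OF assms] cov_def Let_def homogenize_smult homogenize_mult
        degree_qpoly_power homogenize_power[OF degree_qpoly] homogenize_qpoly)
qed

text \<open>For \<open>det g = 1\<close> all determinant factors in the transformation rules
  disappear, so each covariant gives an equivariant map into binary forms.\<close>

lemma homogenize_cov_sym2:
  assumes "x \<in> cov_index a b" "det g = 1"
  shows "homogenize (cov_order a b x) (cov a b x (sym2 g ** h)) z
    = homogenize (cov_order a b x) (cov a b x h) (z v* g)"
proof -
  obtain e k l where x: "x = (e, k, l)" by (cases x)
  have one: "1 *s c = c" for c :: "complex^3" by (simp add: vec_eq_iff)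
  show ?thesis
    using assms(1)
    by (simp add: x homogenize_cov col1_mult dual_form_col12_sym2 jac_sym2 disc_sym2
        quadratic_form_sym2 assms(2) one)
qed

lemma bihom_coeff_mult:
  assumes "\<And>i. bihom p q (\<lambda>h. coeff (P h) i)" "\<And>i. bihom p' q' (\<lambda>h. coeff (Q h) i)"
  shows "bihom (p + p') (q + q') (\<lambda>h. coeff (P h * Q h) i)"
  unfolding coeff_mult by (intro bihom_sum bihom_mult assms) simp

lemma bihom_coeff_power:
  assumes "\<And>i. bihom p q (\<lambda>h. coeff (P h) i)"
  shows "bihom (n * p) (n * q) (\<lambda>h. coeff (P h ^ n) i)"
proof (induction n arbitrary: i)
  case 0
  then show ?case by (cases i) (auto intro: bihom.intros)
next
  case (Suc n)
  then show ?case using bihom_coeff_mult[OF assms, of "n * p" "n * q" "\<lambda>h. P h ^ n"] by simp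
qed

lemma bihom_coeff_qpoly:
  assumes "\<And>j. bihom p q (\<lambda>h. c h $ j)"
  shows "bihom p q (\<lambda>h. coeff (qpoly (c h)) i)"
proof -
  consider "i = 0" | "i = Suc 0" | "i = Suc (Suc 0)" | n where "i = Suc (Suc (Suc n))"
    by (metis not0_implies_Suc)
  then show ?thesis by cases (simp_all add: qpoly_def assms bihom.zero)
qed

lemma bihom_disc:
  assumes "\<And>j. bihom p q (\<lambda>h. c h $ j)"
  shows "bihom (2 * p) (2 * q) (\<lambda>h. disc (c h))"
proof -
  have "bihom (2 * p) (2 * q) (\<lambda>h. c h $ 2 * c h $ 2 - 4 * (c h $ 1 * c h $ 3))"
    unfolding mult_2 by (intro bihom_diff bihom.scale bihom_mult assms)
  then show ?thesis by (simp add: disc_def power2_eq_square mult.assoc)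
qed

lemma bihom_jac:
  assumes "\<And>j. bihom p q (\<lambda>h. c h $ j)" "\<And>j. bihom p' q' (\<lambda>h. d h $ j)"
  shows "bihom (p + p') (q + q') (\<lambda>h. jac (c h) (d h) $ j)"
proof -
  have "bihom (p + p') (q + q') (\<lambda>h. c h $ i * d h $ j - c h $ j * d h $ i)" for i j
    by (intro bihom_diff bihom_mult assms)
  then show ?thesis
    using exhaust_3[of j] bihom.scale[of "p + p'" "q + q'" "\<lambda>h. c h $ 1 * d h $ 3 - c h $ 3 * d h $ 1" 2]
    by (auto simp: jac_def)
qed

lemma bihom_dual_form_col12: "bihom 0 1 (\<lambda>h. dual_form (col12 h) $ j)"
  using exhaust_3[of j] bihom_col12_nth bihom.scale[OF bihom_col12_nth, of "-2" 2]
  by (auto simp: dual_form_def)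

lemma bihom_coeff_cov:
  assumes "x \<in> cov_index a b"
  shows "bihom a b (\<lambda>h. coeff (cov a b x h) i)"
proof -
  obtain e k l where x: "x = (e, k, l)" by (cases x)
  have ix: "2 * k + e \<le> a" "2 * l + e \<le> b" using assms by (auto simp: x cov_index_def)
  let ?G = "\<lambda>h. dual_form (col12 h)"
  note F = bihom_col1_nth and G = bihom_dual_form_col12
  \<comment> \<open>The bidegrees are \<open>(2, 0)\<close> and \<open>(0, 2)\<close> for the
    discriminants, and \<open>(1, 0)\<close>, \<open>(0, 1)\<close> and \<open>(1, 1)\<close> for
    \<open>F\<close>, \<open>G\<close> and \<open>J\<close>. They are left unevaluated so that the
    rules for products and powers match directly.\<close>
  have "bihom ((k * (2 * 1) + l * (2 * 0)) + ((a - 2 * k - e) * 1 + (b - 2 * l - e) * 0 + e * (1 + 0)))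
     ((k * (2 * 0) + l * (2 * 1)) + ((a - 2 * k - e) * 0 + (b - 2 * l - e) * 1 + e * (0 + 1)))
     (\<lambda>h. (disc (col1 h) ^ k * disc (?G h) ^ l) * coeff (qpoly (col1 h) ^ (a - 2 * k - e) * qpoly (?G h) ^ (b - 2 * l - e)
       * qpoly (jac (col1 h) (?G h)) ^ e) i)"
    by (intro bihom_mult bihom_power bihom_disc bihom_coeff_mult bihom_coeff_power bihom_coeff_qpoly bihom_jac F G)
  moreover have "(k * (2 * 1) + l * (2 * 0)) + ((a - 2 * k - e) * 1 + (b - 2 * l - e) * 0 + e * (1 + 0)) = a"
    "(k * (2 * 0) + l * (2 * 1)) + ((a - 2 * k - e) * 0 + (b - 2 * l - e) * 1 + e * (0 + 1)) = b"
    using ix by auto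
  ultimately show ?thesis by (simp add: x cov_def Let_def)
qed

section \<open>Linear independence of the coefficients of the covariants\<close>

lemma bivariate_coeffs_zero:
  fixes c :: "nat \<times> nat \<Rightarrow> complex"
  assumes S: "finite S" and zero: "\<And>u v. u + v \<noteq> 0 \<Longrightarrow> (\<Sum>x\<in>S. c x * u ^ fst x * v ^ snd x) = 0"
    and x: "x \<in> S"
  shows "c x = 0"
proof -
  define N where "N = Max (fst ` S \<union> snd ` S)"
  have N: "S \<subseteq> {..N} \<times> {..N}"
    using S by (auto simp: N_def intro!: Max_ge) (force)+
  define d where "d k l = (if (k, l) \<in> S then c (k, l) else 0)" for k l
  have sum_eq: "(\<Sum>x\<in>S. c x * u ^ fst x * v ^ snd x) = (\<Sum>k\<le>N. (\<Sum>l\<le>N. d k l * v ^ l) * u ^ k)" for u v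
  proof -
    have "(\<Sum>x\<in>S. c x * u ^ fst x * v ^ snd x) = (\<Sum>x\<in>{..N} \<times> {..N}. d (fst x) (snd x) * u ^ fst x * v ^ snd x)"
      using N by (intro sum.mono_neutral_cong_left) (auto simp: d_def)
    also have "\<dots> = (\<Sum>k\<le>N. \<Sum>l\<le>N. d k l * u ^ k * v ^ l)"
      by (subst sum.cartesian_product) (simp add: case_prod_unfold)
    finally show ?thesis unfolding sum_distrib_right by (simp add: mult_ac)
  qed
  \<comment> \<open>For fixed \<open>v\<close> only \<open>u = - v\<close> is excluded, so a
    polynomial in \<open>u\<close> vanishes at infinitely many points and its coefficients are
    zero.\<close>
  have "(\<Sum>l\<le>N. d k l * v ^ l) = 0" if "k \<le> N" for k v
  proof (rule ccontr)
    assume "(\<Sum>l\<le>N. d k l * v ^ l) \<noteq> 0"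
    then have "finite {u. (\<Sum>k\<le>N. (\<Sum>l\<le>N. d k l * v ^ l) * u ^ k) = 0}"
      unfolding polyfun_finite_roots using that by blast
    moreover have "UNIV - {-v} \<subseteq> {u. (\<Sum>k\<le>N. (\<Sum>l\<le>N. d k l * v ^ l) * u ^ k) = 0}"
      using zero[of _ v] by (auto simp: sum_eq add_eq_0_iff2)
    ultimately have "finite (UNIV - {-v})" by (rule finite_subset[rotated])
    then show False using infinite_UNIV_char_0[where 'a = complex] by simp
  qed
  then have "\<forall>l\<le>N. d k l = 0" if "k \<le> N" for k
    using that polyfun_eq_0[where c = "d k" and n = N] by blast
  then show ?thesis using x N unfolding d_def by (cases x) force
qed

lemma sum_cov_index:
  fixes f :: "nat \<times> nat \<times> nat \<Rightarrow> 'a::comm_monoid_add"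
  shows "sum f (cov_index a b) = (\<Sum>k<a div 2 + 1. \<Sum>l<b div 2 + 1. f (0, k, l))
    + (\<Sum>k<(a + 1) div 2. \<Sum>l<(b + 1) div 2. f (1, k, l))"
proof -
  have eq: "cov_index a b = Pair 0 ` ({..<a div 2 + 1} \<times> {..<b div 2 + 1})
      \<union> Pair 1 ` ({..<(a + 1) div 2} \<times> {..<(b + 1) div 2})"
  proof (intro set_eqI)
    fix x :: "nat \<times> nat \<times> nat"
    obtain e k l where x: "x = (e, k, l)" by (cases x)
    have "x \<in> cov_index a b \<longleftrightarrow> e = 0 \<and> 2 * k \<le> a \<and> 2 * l \<le> b \<or> e = 1 \<and> 2 * k + 1 \<le> a \<and> 2 * l + 1 \<le> b"
      by (auto simp: x cov_index_def)
    moreover have "2 * k \<le> a \<longleftrightarrow> k < a div 2 + 1" "2 * l \<le> b \<longleftrightarrow> l < b div 2 + 1"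
      "2 * k + 1 \<le> a \<longleftrightarrow> k < (a + 1) div 2" "2 * l + 1 \<le> b \<longleftrightarrow> l < (b + 1) div 2" by linarith+
    ultimately show "x \<in> cov_index a b \<longleftrightarrow> x \<in> Pair 0 ` ({..<a div 2 + 1} \<times> {..<b div 2 + 1})
      \<union> Pair 1 ` ({..<(a + 1) div 2} \<times> {..<(b + 1) div 2})"
      by (auto simp: x)
  qed
  show ?thesis
    unfolding eq
    by (subst sum.union_disjoint)
       (auto simp: sum.reindex inj_on_def sum.cartesian_product simp del: One_nat_def)
qed

text \<open>At this point the leading coefficients of \<open>F\<close> and \<open>G\<close> are \<open>1\<close>, and that of \<open>J\<close> is a
  square root of \<open>disc F + disc G\<close>, with \<open>disc F\<close> and \<open>disc G\<close> arbitrary.\<close>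

lemma coeff_cov_0:
  "coeff (cov a b (e, k, l) (vector [vector [1, 0, 0], vector [0, 1, 0], vector [- \<delta>, \<beta>, 1]])) 0
    = (4 * \<delta>) ^ k * (4 * (\<beta>\<^sup>2 - \<delta>)) ^ l * (2 * \<beta>) ^ e"
  by (simp add: cov_def Let_def poly_0_coeff_0[symmetric] qpoly_def col1_def col12_def dual_form_def
      disc_def jac_def algebra_simps power2_eq_square)

text \<open>On the test matrices the relation becomes
  \<open>E 0 u (w^2 - u) + w * E 1 u (w^2 - u) = 0\<close>. Changing the sign of \<open>w\<close>
  separates the two parts, and each is a polynomial in the two independent variables
  \<open>u\<close> and \<open>w^2 - u\<close>.\<close>

lemma cov_leading_independent:
  assumes rel: "\<And>h. h \<in> GL3 \<Longrightarrow> (\<Sum>x\<in>cov_index a b. \<kappa> x * coeff (cov a b x h) 0) = 0"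
    and x: "x \<in> cov_index a b"
  shows "\<kappa> x = 0"
proof -
  define S where "S e = {(k, l). (e, k, l) \<in> cov_index a b}" for e
  have fin: "finite (S e)" for e
    by (rule finite_subset[of _ "snd ` cov_index a b"])
       (auto simp: S_def finite_cov_index intro!: image_eqI[rotated])
  define E where "E e u v = (\<Sum>y\<in>S e. \<kappa> (e, y) * u ^ fst y * v ^ snd y)" for e u v
  have cov_index_eq: "cov_index a b = Pair 0 ` S 0 \<union> Pair 1 ` S 1"
    by (auto simp: S_def cov_index_def image_iff le_Suc_eq)
  have E: "E 0 u (w\<^sup>2 - u) + w * E 1 u (w\<^sup>2 - u) = 0" for u w
  proof -
    \<comment> \<open>Scaled so that \<open>disc F = u\<close>, \<open>disc G = w^2 - u\<close> and
      the leading coefficient of \<open>J\<close> is \<open>w\<close>.\<close>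
    define h where "h = (vector [vector [1, 0, 0], vector [0, 1, 0], vector [- (u / 4), w / 2, 1]] :: complex^3^3)"
    have "h \<in> GL3" by (simp add: h_def GL3_iff det_3)
    then have "0 = (\<Sum>x\<in>cov_index a b. \<kappa> x * coeff (cov a b x h) 0)" by (simp add: rel)
    also have "\<dots> = (\<Sum>y\<in>S 0. \<kappa> (0, y) * coeff (cov a b (0, y) h) 0) + (\<Sum>y\<in>S 1. \<kappa> (1, y) * coeff (cov a b (1, y) h) 0)"
      unfolding cov_index_eq using fin by (subst sum.union_disjoint) (auto simp: sum.reindex inj_on_def)
    also have "\<dots> = E 0 u (w\<^sup>2 - u) + w * E 1 u (w\<^sup>2 - u)"
      by (simp add: E_def h_def coeff_cov_0 sum_distrib_left case_prod_unfold power_divide algebra_simps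
          split: prod.split) (auto simp: coeff_cov_0 power_divide algebra_simps intro!: sum.cong arg_cong2[where f="(+)"])
    finally show ?thesis by simp
  qed
  have E01: "E 0 u v = 0 \<and> E 1 u v = 0" if "u + v \<noteq> 0" for u v
  proof -
    \<comment> \<open>As \<open>u + v \<noteq> 0\<close>, this root is nonzero and can be cancelled
      in front of \<open>E 1 u v\<close>.\<close>
    define w where "w = csqrt (u + v)"
    have w: "w\<^sup>2 - u = v" "w \<noteq> 0" using that by (simp_all add: w_def)
    have "E 0 u v + w * E 1 u v = 0" "E 0 u v - w * E 1 u v = 0"
      using E[of u w] E[of u "-w"] w by simp_all
    then have "E 0 u v = 0" "w * E 1 u v = 0" by (simp_all add: eq_neg_iff_add_eq_0)
    then show ?thesis using w by simp
  qed
  obtain e y where ey: "x = (e, y)" by (cases x)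
  then have "e = 0 \<or> e = 1" "y \<in> S e" using x by (auto simp: cov_index_def S_def)
  then show ?thesis
    using bivariate_coeffs_zero[OF fin, where c = "\<lambda>y. \<kappa> (e, y)" and x = y] E01
    unfolding E_def ey by blast
qed

text \<open>The matrix sends \<open>(1, w)\<close> to \<open>(1 + t w, w)\<close>, so the
  equivariance of the covariants can be read off coefficientwise.\<close>

lemma cov_unipotent:
  assumes x: "x \<in> cov_index a b"
  defines "n \<equiv> cov_order a b x"
  shows "cov a b x (sym2 (vector [vector [1, 0], vector [t, 1]]) ** h) =
    (\<Sum>i\<le>n. smult (coeff (cov a b x h) i) (monom 1 i * [:1, t:] ^ (n - i)))"
proof -
  define g where "g = (vector [vector [1, 0], vector [t, 1]] :: complex^2^2)"
  have g: "det g = 1" by (simp add: g_def det_2)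
  have "poly (cov a b x (sym2 g ** h)) w =
      poly (\<Sum>i\<le>n. smult (coeff (cov a b x h) i) (monom 1 i * [:1, t:] ^ (n - i))) w" for w
  proof -
    define z where "z = (vector [1, w] :: complex^2)"
    have z: "z $ 1 = 1" "z $ 2 = w" by (simp_all add: z_def)
    have "poly (cov a b x (sym2 g ** h)) w = homogenize n (cov a b x (sym2 g ** h)) z"
      using degree_cov[OF x] by (simp add: homogenize_poly n_def z)
    also have "\<dots> = homogenize n (cov a b x h) (z v* g)"
      unfolding n_def by (rule homogenize_cov_sym2[OF x g])
    also have "\<dots> = (\<Sum>i\<le>n. coeff (cov a b x h) i * (1 + w * t) ^ (n - i) * w ^ i)"
      by (simp add: homogenize_def vector_matrix_mult_def sum_2 z g_def mult.commute)
    finally show ?thesis by (simp add: poly_sum poly_monom mult_ac)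
  qed
  then show ?thesis unfolding g_def by (simp add: poly_eq_poly_eq_iff[symmetric] fun_eq_iff)
qed

text \<open>Translating a relation by a lower unipotent element of parameter \<open>t\<close> and extracting the highest
  power of \<open>t\<close> leaves a relation between leading coefficients only.\<close>

lemma cov_independent:
  assumes rel: "\<And>h. h \<in> GL3 \<Longrightarrow>
      (\<Sum>x\<in>cov_index a b. \<Sum>i\<le>cov_order a b x. \<kappa> x i * coeff (cov a b x h) i) = 0"
    and x: "x \<in> cov_index a b" "i \<le> cov_order a b x"
  shows "\<kappa> x i = 0"
proof (rule ccontr)
  let ?I = "cov_index a b" and ?n = "cov_order a b"
  assume "\<kappa> x i \<noteq> 0"
  define D where "D = {i. \<exists>x\<in>?I. i \<le> ?n x \<and> \<kappa> x i \<noteq> 0}"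
  have "D \<subseteq> (\<Union>x\<in>?I. {..?n x})" by (auto simp: D_def)
  then have finD: "finite D" using finite_cov_index finite_subset by blast
  have "i \<in> D" using x \<open>\<kappa> x i \<noteq> 0\<close> by (auto simp: D_def)
  define d where "d = Max D"
  have "d \<in> D" using finD \<open>i \<in> D\<close> Max_in unfolding d_def by blast
  have top: "\<kappa> y j = 0" if "y \<in> ?I" "j \<le> ?n y" "d < j" for y j
    using that Max_ge[OF finD, of j] by (auto simp: D_def d_def)
  have lead: "(\<Sum>y\<in>?I. (if d \<le> ?n y then \<kappa> y d * of_nat (?n y choose d) else 0) * coeff (cov a b y h) 0) = 0"
    if h: "h \<in> GL3" for h
  proof -
    define B where "B y i = coeff (cov a b y h) i" for y i
    \<comment> \<open>The translated relation as a polynomial in \<open>t\<close>: coefficient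
      \<open>i\<close> of a covariant enters coefficient \<open>j\<close> of its translate with the
      factor \<open>t ^ (j - i)\<close> and a binomial coefficient.\<close>
    define Q where "Q = (\<Sum>y\<in>?I. \<Sum>j\<le>?n y. \<Sum>i\<le>?n y.
      if i \<le> j then monom (\<kappa> y j * B y i * of_nat (?n y - i choose (j - i))) (j - i) else 0)"
    have "poly Q t = 0" for t
    proof -
      define g where "g = (vector [vector [1, 0], vector [t, 1]] :: complex^2^2)"
      have "g \<in> SL2" by (simp add: g_def SL2_def det_2)
      then have "sym2 g ** h \<in> GL3" using h by (intro GL3_mult sym2_in_GL3)
      then have "0 = (\<Sum>y\<in>?I. \<Sum>j\<le>?n y. \<kappa> y j * coeff (cov a b y (sym2 g ** h)) j)"
        by (simp add: rel)
      also have "\<dots> = (\<Sum>y\<in>?I. \<Sum>j\<le>?n y. \<Sum>i\<le>?n y. \<kappa> y j * (B y i *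
          (if i \<le> j then coeff ([:1, t:] ^ (?n y - i)) (j - i) else 0)))"
        by (simp add: cov_unipotent g_def coeff_sum coeff_monom_mult sum_distrib_left B_def)
          (intro sum.cong refl, simp)
      also have "\<dots> = poly Q t"
        unfolding Q_def poly_sum
        by (intro sum.cong refl) (auto simp: poly_monom coeff_linear_poly_power)
      finally show ?thesis by simp
    qed
    then have "Q = 0" using poly_all_0_iff_0 by blast
    then have "0 = coeff Q d" by simp
    \<comment> \<open>As \<open>\<kappa> y j = 0\<close> for \<open>j > d\<close>, a surviving term
      has \<open>j - i = d\<close> only for \<open>i = 0\<close> and \<open>j = d\<close>.\<close>
    also have "\<dots> = (\<Sum>y\<in>?I. \<Sum>j\<le>?n y. \<Sum>i\<le>?n y. if i = 0 \<and> j = d then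
        \<kappa> y d * B y 0 * of_nat (?n y choose d) else 0)"
      unfolding Q_def coeff_sum
    proof (intro sum.cong refl)
      fix y j i assume "y \<in> ?I" "j \<in> {..?n y}" "i \<in> {..?n y}"
      then show "coeff (if i \<le> j then monom (\<kappa> y j * B y i * of_nat (?n y - i choose (j - i))) (j - i) else 0) d
        = (if i = 0 \<and> j = d then \<kappa> y d * B y 0 * of_nat (?n y choose d) else 0)"
        using top[of y j] by (cases "d < j") auto
    qed
    also have "\<dots> = (\<Sum>y\<in>?I. (if d \<le> ?n y then \<kappa> y d * of_nat (?n y choose d) else 0) * coeff (cov a b y h) 0)"
    proof (intro sum.cong refl)
      fix y
      have "(\<Sum>j\<le>?n y. \<Sum>i\<le>?n y. if i = 0 \<and> j = d then \<kappa> y d * B y 0 * of_nat (?n y choose d) else 0)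
        = (\<Sum>j\<le>?n y. if j = d then (\<Sum>i\<le>?n y. if i = 0 then \<kappa> y d * B y 0 * of_nat (?n y choose d) else 0) else 0)"
        by (intro sum.cong refl) auto
      then show "(\<Sum>j\<le>?n y. \<Sum>i\<le>?n y. if i = 0 \<and> j = d then \<kappa> y d * B y 0 * of_nat (?n y choose d) else 0)
        = (if d \<le> ?n y then \<kappa> y d * of_nat (?n y choose d) else 0) * coeff (cov a b y h) 0"
        by (simp add: B_def)
    qed
    finally show ?thesis by simp
  qed
  obtain y where y: "y \<in> ?I" "d \<le> ?n y" "\<kappa> y d \<noteq> 0" using \<open>d \<in> D\<close> by (auto simp: D_def)
  \<comment> \<open>The binomial coefficient \<open>?n y choose d\<close> is nonzero because
    \<open>d \<le> ?n y\<close>.\<close>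
  show False using cov_leading_independent[OF lead y(1)] y by simp
qed

section \<open>Dimension count\<close>

lemma sum_affine:
  fixes c :: int
  shows "(\<Sum>k<m. \<Sum>l<n. c - 4 * int k - 4 * int l) =
    int m * int n * c - 2 * int n * (int m * (int m - 1)) - 2 * int m * (int n * (int n - 1))"
proof -
  have 1: "2 * (\<Sum>k<m. int k) = int m * (int m - 1)" for m
    by (induction m) (auto simp: algebra_simps)
  have "(\<Sum>k<m. \<Sum>l<n. c - 4 * int k - 4 * int l) = int m * int n * c - 2 * int n * (2 * (\<Sum>k<m. int k)) - 2 * int m * (2 * (\<Sum>l<n. int l))"
    by (simp add: sum_subtractf sum_distrib_left sum.distrib algebra_simps)
  then show ?thesis unfolding 1 .
qed

text \<open>The covariants are numerous enough: the total is again Weyl's dimension. The computation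
  runs over the integers, where the differences in \<open>cov_order\<close>, genuine on
  \<open>cov_index\<close>, are affine.\<close>

lemma sum_cov_order: "(\<Sum>x\<in>cov_index a b. cov_order a b x + 1) * 2 = (a + 1) * (b + 1) * (a + b + 2)"
proof -
  have "int (\<Sum>x\<in>cov_index a b. cov_order a b x + 1) = (\<Sum>x\<in>cov_index a b.
      2 * (int a + int b) + 1 - 2 * int (fst x) - 4 * int (fst (snd x)) - 4 * int (snd (snd x)))"
    unfolding of_nat_sum
    by (intro sum.cong refl) (auto simp: cov_order_def cov_index_def)
  also have "\<dots> = (\<Sum>k<a div 2 + 1. \<Sum>l<b div 2 + 1. (2 * (int a + int b) + 1) - 4 * int k - 4 * int l)
    + (\<Sum>k<(a + 1) div 2. \<Sum>l<(b + 1) div 2. (2 * (int a + int b) - 1) - 4 * int k - 4 * int l)"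
    by (subst sum_cov_index) simp
  finally have *: "int (\<Sum>x\<in>cov_index a b. cov_order a b x + 1) = \<dots>" .
  have "int ((\<Sum>x\<in>cov_index a b. cov_order a b x + 1) * 2) = int ((a + 1) * (b + 1) * (a + b + 2))"
    unfolding of_nat_mult * sum_affine
    by (cases "even a"; cases "even b"; elim evenE oddE) (simp_all add: algebra_simps)
  then show ?thesis by (simp only: of_nat_eq_iff)
qed

definition cov_coeffs :: "nat \<Rightarrow> nat \<Rightarrow> (complex^3^3 \<Rightarrow> complex) set" where
  "cov_coeffs a b = (\<lambda>(x, i) h. coeff (cov a b x h) i) ` Sigma (cov_index a b) (\<lambda>x. {..cov_order a b x})"

text \<open>The coefficient functions are independent, lie in the span of the reduced monomials and
  are at least as many, hence span the same space.\<close>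

lemma bihom_in_span_cov_coeffs:
  assumes "bihom a b F"
  shows "F \<in> fs.span (cov_coeffs a b)"
proof -
  let ?S = "Sigma (cov_index a b) (\<lambda>x. {..cov_order a b x})"
  let ?f = "\<lambda>(x, i) h. coeff (cov a b x h) i"
  have fin: "finite ?S" using finite_cov_index by auto
  have indep: "\<kappa> s = 0" if "\<And>h. (\<Sum>s\<in>?S. \<kappa> s * ?f s h) = 0" "s \<in> ?S" for \<kappa> s
  proof -
    have "\<kappa> (fst s, snd s) = 0"
      using that finite_cov_index
      by (intro cov_independent[where \<kappa> = "\<lambda>x i. \<kappa> (x, i)"]) (auto simp: sum.Sigma case_prod_unfold)
    then show ?thesis by simp
  qed
  \<comment> \<open>Distinct labels give distinct functions; this turns independence of the family
    into independence of the set and fixes its size.\<close>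
  have inj: "inj_on ?f ?S"
  proof (rule inj_onI, rule ccontr)
    fix s s' assume s: "s \<in> ?S" "s' \<in> ?S" "?f s = ?f s'" "s \<noteq> s'"
    have "(\<Sum>r\<in>?S. ((if r = s then 1 else 0) - (if r = s' then 1 else 0)) * ?f r h) = ?f s h - ?f s' h" for h
      using fin s(1,2) by (simp add: left_diff_distrib sum_subtractf if_distrib[of "\<lambda>x. x * _"] cong: if_cong)
    then have "(if s = s then 1 else 0) - (if s = s' then 1 else 0) = (0::complex)"
      using s by (intro indep[of "\<lambda>r. (if r = s then 1 else 0) - (if r = s' then 1 else 0)"]) auto
    then show False using s(4) by simp
  qed
  have ind: "fs.independent (cov_coeffs a b)"
    unfolding cov_coeffs_def
  proof (subst fs.dependent_finite, use fin in blast, rule notI)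
    assume "\<exists>u. (\<exists>v\<in>?f ` ?S. u v \<noteq> 0) \<and> (\<Sum>v\<in>?f ` ?S. (\<lambda>x. u v * v x)) = 0"
    then obtain u s where u: "s \<in> ?S" "u (?f s) \<noteq> 0" "(\<Sum>v\<in>?f ` ?S. (\<lambda>x. u v * v x)) = 0" by blast
    have "(\<Sum>s\<in>?S. u (?f s) * ?f s h) = (\<Sum>v\<in>?f ` ?S. (\<lambda>x. u v * v x)) h" for h
      unfolding sum_fun_apply sum.reindex[OF inj] o_def ..
    then have "(\<Sum>s\<in>?S. u (?f s) * ?f s h) = 0" for h unfolding u(3) by simp
    then show False using indep[of "\<lambda>s. u (?f s)" s] u by blast
  qed
  have sub: "cov_coeffs a b \<subseteq> fs.span (reduced_monomials a b)"
    by (auto simp: cov_coeffs_def intro!: bihom_in_span bihom_coeff_cov)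
  have fincov: "finite (cov_coeffs a b)" using fin by (simp add: cov_coeffs_def)
  have "card (cov_coeffs a b) = (\<Sum>x\<in>cov_index a b. cov_order a b x + 1)"
    unfolding cov_coeffs_def by (simp add: card_image[OF inj] finite_cov_index)
  then have card: "card (reduced_monomials a b) \<le> card (cov_coeffs a b)"
    using card_reduced_monomials(2)[of a b] sum_cov_order[of a b] by linarith
  show ?thesis
  proof (rule ccontr)
    \<comment> \<open>Adjoining \<open>F\<close> would give an independent set larger than the set
      of reduced monomials, whose span contains it.\<close>
    assume F: "F \<notin> fs.span (cov_coeffs a b)"
    then have "F \<notin> cov_coeffs a b" using fs.span_base by blast
    have "card (insert F (cov_coeffs a b)) \<le> card (reduced_monomials a b)"
      using fs.independent_span_bound[OF card_reduced_monomials(1) fs.independent_insertI[OF F ind]]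
        sub bihom_in_span[OF assms] by blast
    then show False using card fincov \<open>F \<notin> cov_coeffs a b\<close> by simp
  qed
qed

section \<open>The restriction to the principal subgroup\<close>

lemma (in vector_space) span_image_explicit:
  assumes "m \<in> span (g ` X)"
  obtains A c where "finite A" "A \<subseteq> X" "m = (\<Sum>x\<in>A. scale (c x) (g x))"
proof -
  obtain B r where B: "finite B" "B \<subseteq> g ` X" and m: "m = (\<Sum>b\<in>B. scale (r b) b)"
    using assms unfolding span_explicit by blast
  obtain A where A: "A \<subseteq> X" "inj_on g A" "B = g ` A" using B(2) by (auto simp: subset_image_inj)
  have "finite A" using B(1) A finite_image_iff by blast
  then show thesis using that[of A "\<lambda>x. r (g x)"] A m by (simp add: sum.reindex)
qed

text \<open>If the evaluation vectors at points of \<open>X\<close> did not span the vector of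
  prescribed values, a linear functional would vanish on all of them but not on it; its coefficients
  would be a nontrivial relation between the functions.\<close>

lemma evaluation_onto:
  fixes f :: "'s \<Rightarrow> 'a \<Rightarrow> complex"
  assumes S: "finite S"
    and indep: "\<And>\<kappa> s. (\<And>a. a \<in> X \<Longrightarrow> (\<Sum>s\<in>S. \<kappa> s * f s a) = 0) \<Longrightarrow> s \<in> S \<Longrightarrow> \<kappa> s = 0"
  obtains A c where "finite A" "A \<subseteq> X" "\<And>s. s \<in> S \<Longrightarrow> (\<Sum>a\<in>A. c a * f s a) = y s"
proof -
  \<comment> \<open>Vectors of values are extended by zero outside \<open>S\<close>, so that they
    are combinations of the finitely many unit vectors \<open>\<delta> s\<close>.\<close>
  define r where "r g = (\<lambda>s. if s \<in> S then g s else (0::complex))" for g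
  let ?E = "(\<lambda>a. r (\<lambda>s. f s a)) ` X"
  have "vector_space ((*) :: complex \<Rightarrow> complex \<Rightarrow> complex)"
    by unfold_locales (simp_all add: distrib_left distrib_right)
  then interpret pair: vector_space_pair fscale "(*) :: complex \<Rightarrow> complex \<Rightarrow> complex"
    using fs.vector_space_axioms by (simp add: vector_space_pair_def)
  have "r y \<in> fs.span ?E"
  proof (rule ccontr)
    assume y: "r y \<notin> fs.span ?E"
    obtain B where B: "B \<subseteq> ?E" "fs.independent B" "?E \<subseteq> fs.span B"
      using fs.maximal_independent_subset by blast
    have "fs.span B = fs.span ?E"
      unfolding fs.span_eq using B(1,3) fs.span_superset[of ?E] by blast
    then have "fs.independent (insert (r y) B)" using y B(2) by (simp add: fs.independent_insertI)
    then obtain l where l: "Vector_Spaces.linear fscale (*) l"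
        "\<forall>x\<in>insert (r y) B. l x = (if x = r y then 1 else 0)"
      using pair.linear_independent_extend[of _ "\<lambda>x. if x = r y then 1 else 0"] by blast
    interpret l: Vector_Spaces.linear fscale "(*)" l by (rule l(1))
    have "r y \<notin> B" using y B(1) fs.span_base by blast
    then have lB: "l x = 0" if "x \<in> B" for x using l(2) that by auto
    have l0: "l x = 0" if "x \<in> ?E" for x
      using that B(3) l.eq_0_on_span[of B x] lB by blast
    define \<delta> where "\<delta> s = (\<lambda>s'. if s' = s then 1 else (0::complex))" for s :: 's
    have lr: "l (r g) = (\<Sum>s\<in>S. l (\<delta> s) * g s)" for g
    proof -
      have "r g = (\<Sum>s\<in>S. (\<lambda>x. g s * \<delta> s x))"
        by (rule ext) (simp add: sum_fun_apply r_def \<delta>_def S if_distrib[of "\<lambda>x. _ * x"] cong: if_cong)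
      then show ?thesis by (simp add: l.sum l.scale mult.commute)
    qed
    have "l (\<delta> s) = 0" if "s \<in> S" for s
      using indep[of "\<lambda>s. l (\<delta> s)" s] that l0 by (simp add: lr[symmetric])
    then have "l (r y) = 0" by (simp add: lr)
    then show False using l(2) by simp
  qed
  then obtain A c where A: "finite A" "A \<subseteq> X" and y: "r y = (\<Sum>a\<in>A. (\<lambda>s. c a * r (\<lambda>s. f s a) s))"
    by (rule fs.span_image_explicit)
  have "(\<Sum>a\<in>A. c a * f s a) = y s" if "s \<in> S" for s
    using fun_cong[OF y, of s] that by (simp add: sum_fun_apply r_def)
  then show thesis using that A by blast
qed

text \<open>Links two labellings: \<open>irr_sum N\<close> labels its summands by pairs
  \<open>(n, i)\<close>, whereas the covariants are labelled by the elements of their own index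
  set.\<close>

lemma multiplicity_indexing:
  fixes d :: "'a \<Rightarrow> nat"
  assumes "finite I"
  defines "N \<equiv> (\<Sum>x\<in>I. {#d x#})"
  obtains \<beta> where "bij_betw \<beta> {(n, i). i < count N n} I"
    "\<And>n i. i < count N n \<Longrightarrow> d (\<beta> (n, i)) = n"
proof -
  have count: "count N n = card {x \<in> I. d x = n}" for n
    unfolding card_eq_sum sum.inter_filter[OF assms(1)] N_def count_sum by (rule sum.cong) auto
  have "\<exists>\<gamma>. bij_betw \<gamma> {..<count N n} {x \<in> I. d x = n}" for n
    using ex_bij_betw_nat_finite[of "{x \<in> I. d x = n}"] assms(1) by (simp add: count atLeast0LessThan)
  then obtain \<gamma> where \<gamma>: "\<And>n. bij_betw (\<gamma> n) {..<count N n} {x \<in> I. d x = n}" by metis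
  define \<beta> where "\<beta> = (\<lambda>(n, i). \<gamma> n i)"
  have mem: "\<gamma> n i \<in> I \<and> d (\<gamma> n i) = n" if "i < count N n" for n i
    using bij_betwE[OF \<gamma>[of n]] that by blast
  have "bij_betw \<beta> {(n, i). i < count N n} I"
  proof (rule bij_betwI')
    fix p q assume "p \<in> {(n, i). i < count N n}" "q \<in> {(n, i). i < count N n}"
    moreover obtain n i n' i' where "p = (n, i)" "q = (n', i')" by (metis surj_pair)
    ultimately show "(\<beta> p = \<beta> q) = (p = q)"
      using mem bij_betw_imp_inj_on[OF \<gamma>[of n]] by (auto simp: \<beta>_def inj_on_def) (metis lessThan_iff mem)+
  next
    fix p assume "p \<in> {(n, i). i < count N n}"
    then show "\<beta> p \<in> I" using mem by (auto simp: \<beta>_def)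
  next
    fix x assume "x \<in> I"
    then have "x \<in> \<gamma> (d x) ` {..<count N (d x)}" using bij_betw_imp_surj_on[OF \<gamma>[of "d x"]] by blast
    then show "\<exists>p\<in>{(n, i). i < count N n}. x = \<beta> p" by (auto simp: \<beta>_def)
  qed
  then show thesis using that mem by (auto simp: \<beta>_def)
qed

lemma homogenize_sum:
  "(\<Sum>h\<in>A. c h * homogenize n (p h) z) = homogenize n (\<Sum>h\<in>A. smult (c h) (p h)) z"
  unfolding homogenize_def coeff_sum sum_distrib_left sum_distrib_right
  by (subst sum.swap) (simp add: mult.assoc)

lemma homogenize_eq_0_iff: "(\<forall>z. homogenize n p z = 0) \<longleftrightarrow> (\<forall>i\<le>n. coeff p i = 0)"
proof
  assume "\<forall>z. homogenize n p z = 0"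
  then have "homogenize n p (vector [1, w]) = 0" for w by blast
  then have "\<forall>w. (\<Sum>i\<le>n. coeff p i * w ^ i) = 0" by (simp add: homogenize_def)
  then show "\<forall>i\<le>n. coeff p i = 0" by (simp add: polyfun_eq_0)
qed (simp add: homogenize_def)

text \<open>The isomorphism sends \<open>act M h v\<close> to the tuple of all covariants evaluated
  at \<open>h\<close>. Equality of linear relations makes it well defined and injective,
  independence of the coefficients makes it onto, and covariance makes it equivariant.\<close>

lemma sym2_restriction:
  fixes M :: "(complex^3^3, 'v::ab_group_add) gmodule"
  assumes "irreducible_GL3_with_highest_weight M (int a *s omega1 + int b *s omega2)"
  shows "isomorphic_gmodules SL2 (pullback sym2 M) (irr_sum (\<Sum>x\<in>cov_index a b. {#cov_order a b x + 1#}))"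
proof -
  let ?I = "cov_index a b" and ?n = "cov_order a b"
  define N where "N = (\<Sum>x\<in>?I. {#?n x + 1#})"
  obtain v where irr: "irreducible_representation GL3 M" and rat: "rational_representation GL3 M"
    and hw: "highest_weight_vector M (int a *s omega1 + int b *s omega2) v"
    using assms unfolding irreducible_GL3_with_highest_weight_def by blast
  have rep: "representation GL3 M" using irr by (simp add: irreducible_representation_def)
  have v: "v \<in> vecs M" "v \<noteq> 0" using hw by (auto simp: highest_weight_vector_def)
  interpret V: vector_space "scal M" by (rule rep_vector_space[OF rep])
  interpret W: vector_space "scal (irr_sum N)"
    by unfold_locales (simp_all add: irr_sum_def Sym_def fun_eq_iff distrib_left distrib_right)
  obtain \<beta> where \<beta>: "bij_betw \<beta> {(n, i). i < count N n} ?I"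
    and "\<And>n i. i < count N n \<Longrightarrow> ?n (\<beta> (n, i)) + 1 = n"
    using multiplicity_indexing[OF finite_cov_index, of "\<lambda>x. ?n x + 1"] unfolding N_def by blast
  then have dim: "?n (\<beta> (n, i)) = n - 1" if "i < count N n" for n i
    using that by fastforce
  have \<beta>_mem: "\<beta> (n, i) \<in> ?I" if "i < count N n" for n i
    using bij_betwE[OF \<beta>] that by blast
  \<comment> \<open>The intended image of \<open>act M h v\<close>; the summand of dimension
    \<open>n\<close> carries forms of degree \<open>n - 1\<close>.\<close>
  define \<eta> where "\<eta> h = (\<lambda>(n, i). if i < count N n then homogenize (n - 1) (cov a b (\<beta> (n, i)) h) else 0)" for h
  define comb where "comb A c p = (\<Sum>h\<in>A. scal (irr_sum N) (c h) (\<eta> h)) p" for A c p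
  have comb: "comb A c (n, i) = (if i < count N n then
      homogenize (n - 1) (\<Sum>h\<in>A. smult (c h) (cov a b (\<beta> (n, i)) h)) else 0)" for A c n i
    by (auto simp: comb_def sum_fun_apply irr_sum_def Sym_def \<eta>_def fun_eq_iff homogenize_sum)
  have comb_0: "comb A c = 0 \<longleftrightarrow> (\<Sum>h\<in>A. scal M (c h) (act M h v)) = 0" if A: "finite A" "A \<subseteq> GL3" for A c
  proof -
    have "comb A c = 0 \<longleftrightarrow> (\<forall>n i. i < count N n \<longrightarrow> (\<forall>z. homogenize (n - 1) (\<Sum>h\<in>A. smult (c h) (cov a b (\<beta> (n, i)) h)) z = 0))"
      by (auto simp: fun_eq_iff comb)
    also have "\<dots> \<longleftrightarrow> (\<forall>n i. i < count N n \<longrightarrow> (\<forall>j\<le>n - 1. (\<Sum>h\<in>A. c h * coeff (cov a b (\<beta> (n, i)) h) j) = 0))"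
      by (simp add: homogenize_eq_0_iff coeff_sum)
    also have "\<dots> \<longleftrightarrow> (\<forall>p\<in>{(n, i). i < count N n}. \<forall>j\<le>?n (\<beta> p). (\<Sum>h\<in>A. c h * coeff (cov a b (\<beta> p) h) j) = 0)"
      using dim by auto
    also have "\<dots> \<longleftrightarrow> (\<forall>x\<in>?I. \<forall>j\<le>?n x. (\<Sum>h\<in>A. c h * coeff (cov a b x h) j) = 0)"
      unfolding bij_betw_imp_surj_on[OF \<beta>, symmetric] by blast
    \<comment> \<open>Forwards, flag monomials lie in the span of the coefficients of the
      covariants; backwards, these coefficients are bihomogeneous and \<open>bihom_relations\<close>
      applies.\<close>
    also have "\<dots> \<longleftrightarrow> (\<forall>g. (\<Sum>h\<in>A. c h * flag_monomial a b (g ** h)) = 0)"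
    proof (intro iffI allI)
      fix g assume *: "\<forall>x\<in>?I. \<forall>j\<le>?n x. (\<Sum>h\<in>A. c h * coeff (cov a b x h) j) = 0"
      have "F \<in> fs.span (cov_coeffs a b) \<Longrightarrow> (\<Sum>h\<in>A. c h * F h) = 0" for F
      proof (induction rule: fs.span_induct_alt)
        case (step r x y)
        then have "r * (\<Sum>h\<in>A. c h * x h) + (\<Sum>h\<in>A. c h * y h) = 0"
          using * by (auto simp: cov_coeffs_def)
        then show ?case by (simp add: plus_fun_def sum_distrib_left sum.distrib algebra_simps)
      qed simp
      then show "(\<Sum>h\<in>A. c h * flag_monomial a b (g ** h)) = 0"
        using bihom_in_span_cov_coeffs[OF bihom_flag_monomial, of a b g] by blast
    next
      assume "\<forall>g. (\<Sum>h\<in>A. c h * flag_monomial a b (g ** h)) = 0"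
      then show "\<forall>x\<in>?I. \<forall>j\<le>?n x. (\<Sum>h\<in>A. c h * coeff (cov a b x h) j) = 0"
        using bihom_relations[OF A(1)] bihom_coeff_cov by blast
    qed
    also have "\<dots> \<longleftrightarrow> (\<Sum>h\<in>A. scal M (c h) (act M h v)) = 0"
      using orbit_relation_iff[OF irr rat hw A] by blast
    finally show ?thesis .
  qed
  have "\<exists>T. Vector_Spaces.linear (scal M) (scal (irr_sum N)) T \<and> (\<forall>h\<in>GL3. T (act M h v) = \<eta> h)"
    using comb_0 by (intro linear_map_from_relations V.vector_space_axioms W.vector_space_axioms)
      (auto simp: comb_def[abs_def])
  then obtain T where T: "Vector_Spaces.linear (scal M) (scal (irr_sum N)) T"
    and T\<eta>: "\<And>h. h \<in> GL3 \<Longrightarrow> T (act M h v) = \<eta> h" by blast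
  interpret T: Vector_Spaces.linear "scal M" "scal (irr_sum N)" T by (rule T)
  have T_comb: "T (\<Sum>h\<in>A. scal M (c h) (act M h v)) = comb A c" if "A \<subseteq> GL3" for A c
    using that unfolding comb_def T.sum T.scale by (auto simp: T\<eta> subset_iff intro!: sum.cong)
  have expand: "\<exists>A c. finite A \<and> A \<subseteq> GL3 \<and> m = (\<Sum>h\<in>A. scal M (c h) (act M h v))" if "m \<in> vecs M" for m
    using that unfolding irreducible_orbit_span[OF irr v, symmetric] by (elim V.span_image_explicit) blast
  have closed: "(\<Sum>h\<in>A. scal M (c h) (act M h v)) \<in> vecs M" if "A \<subseteq> GL3" for A c
    using that rep_closed[OF rep] v
    by (auto intro!: V.subspace_sum V.subspace_scale rep_subspace[OF rep])
  have "m = 0" if T0: "T m = 0" and mM: "m \<in> vecs M" for m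
  proof -
    obtain A c where A: "finite A" "A \<subseteq> GL3" and m: "m = (\<Sum>h\<in>A. scal M (c h) (act M h v))"
      using expand[OF mM] by blast
    then show ?thesis using T0 T_comb[OF A(2), of c] comb_0[OF A, of c] by simp
  qed
  then have "inj_on T (vecs M)"
    using rep_subspace[OF rep] by (subst T.inj_on_iff_eq_0) auto
  moreover have "T ` vecs M = vecs (irr_sum N)"
  proof (intro subset_antisym subsetI)
    fix f assume "f \<in> T ` vecs M"
    then obtain A c where "A \<subseteq> GL3" "f = comb A c" using expand T_comb by blast
    then show "f \<in> vecs (irr_sum N)"
      by (auto simp: irr_sum_def comb homogenize_in_Sym)
  next
    fix f assume f: "f \<in> vecs (irr_sum N)"
    have ex: "\<exists>c. f (n, i) = (\<lambda>z. \<Sum>j\<le>n - 1. c j * (z $ 1) ^ (n - 1 - j) * (z $ 2) ^ j)" if "i < count N n" for n i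
      using f that by (auto simp: irr_sum_def Sym_def)
    define c where "c n i = (SOME c. f (n, i) = (\<lambda>z. \<Sum>j\<le>n - 1. c j * (z $ 1) ^ (n - 1 - j) * (z $ 2) ^ j))" for n i
    have c: "f (n, i) = (\<lambda>z. \<Sum>j\<le>n - 1. c n i j * (z $ 1) ^ (n - 1 - j) * (z $ 2) ^ j)" if "i < count N n" for n i
      unfolding c_def by (rule someI_ex[OF ex[OF that]])
    \<comment> \<open>The coefficients of \<open>f\<close>, relabelled by covariants through the
      inverse of \<open>\<beta>\<close>, are the values to be attained by a combination of
      evaluations.\<close>
    define y where "y = (\<lambda>(x, j). let (n, i) = the_inv_into {(n, i). i < count N n} \<beta> x in c n i j)"
    have y: "y (\<beta> (n, i), j) = c n i j" if "i < count N n" for n i j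
      using that bij_betw_imp_inj_on[OF \<beta>] by (simp add: y_def the_inv_into_f_f)
    have fin: "finite (Sigma ?I (\<lambda>x. {..?n x}))" using finite_cov_index by auto
    obtain A e where A: "finite A" "A \<subseteq> GL3"
      and e: "\<And>s. s \<in> Sigma ?I (\<lambda>x. {..?n x}) \<Longrightarrow> (\<Sum>h\<in>A. e h * coeff (cov a b (fst s) h) (snd s)) = y s"
    proof (rule evaluation_onto[OF fin, where X = GL3 and f = "\<lambda>s h. coeff (cov a b (fst s) h) (snd s)" and y = y])
      fix \<kappa> :: "(nat \<times> nat \<times> nat) \<times> nat \<Rightarrow> complex" and s
      assume "\<And>h. h \<in> GL3 \<Longrightarrow> (\<Sum>s\<in>Sigma ?I (\<lambda>x. {..?n x}). \<kappa> s * coeff (cov a b (fst s) h) (snd s)) = 0"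
        and s: "s \<in> Sigma ?I (\<lambda>x. {..?n x})"
      then have "\<kappa> (fst s, snd s) = 0"
        using finite_cov_index
        by (intro cov_independent[where \<kappa> = "\<lambda>x i. \<kappa> (x, i)"]) (auto simp: sum.Sigma case_prod_unfold)
      then show "\<kappa> s = 0" by simp
    qed blast
    have "f = comb A e"
    proof (rule ext)
      fix p :: "nat \<times> nat"
      obtain n i where p: "p = (n, i)" by (cases p)
      show "f p = comb A e p"
      proof (cases "i < count N n")
        case True
        have "c n i j = coeff (\<Sum>h\<in>A. smult (e h) (cov a b (\<beta> (n, i)) h)) j" if "j \<le> n - 1" for j
          using e[of "(\<beta> (n, i), j)"] True that \<beta>_mem[OF True] dim[OF True] y[OF True]
          by (simp add: coeff_sum)
        then show ?thesis using True c[OF True] by (simp add: p comb homogenize_def)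
      next
        case False
        then show ?thesis using f by (simp add: p comb irr_sum_def)
      qed
    qed
    then show "f \<in> T ` vecs M"
      unfolding T_comb[OF A(2), symmetric] using closed[OF A(2)] by simp
  qed
  moreover have "T (act M (sym2 g) m) = act (irr_sum N) g (T m)" if g: "g \<in> SL2" and m: "m \<in> vecs M" for g m
  proof -
    have G: "sym2 g \<in> GL3" using g by (rule sym2_in_GL3)
    obtain A c where A: "finite A" "A \<subseteq> GL3" and m: "m = (\<Sum>h\<in>A. scal M (c h) (act M h v))"
      using expand[OF m] by blast
    have "act M (sym2 g) m = (\<Sum>h\<in>A. scal M (c h) (act M (sym2 g) (act M h v)))"
      unfolding m using A v rep_closed[OF rep] by (intro rep_act_sum[OF rep G]) auto
    then have "T (act M (sym2 g) m) = (\<Sum>h\<in>A. scal (irr_sum N) (c h) (T (act M (sym2 g) (act M h v))))"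
      by (simp add: T.sum T.scale)
    also have "\<dots> = (\<Sum>h\<in>A. scal (irr_sum N) (c h) (\<eta> (sym2 g ** h)))"
    proof (intro sum.cong refl)
      fix h assume "h \<in> A"
      then have h: "h \<in> GL3" using A by blast
      have "act M (sym2 g) (act M h v) = act M (sym2 g ** h) v" using rep_mult[OF rep G h v(1)] by simp
      then show "scal (irr_sum N) (c h) (T (act M (sym2 g) (act M h v))) = scal (irr_sum N) (c h) (\<eta> (sym2 g ** h))"
        using T\<eta>[OF GL3_mult[OF G h]] by simp
    qed
    also have "\<dots> = act (irr_sum N) g (comb A c)"
    proof (rule ext, rule ext)
      fix p :: "nat \<times> nat" and z :: "complex^2"
      obtain n i where p: "p = (n, i)" by (cases p)
      show "(\<Sum>h\<in>A. scal (irr_sum N) (c h) (\<eta> (sym2 g ** h))) p z = act (irr_sum N) g (comb A c) p z"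
      proof (cases "i < count N n")
        case True
        have "homogenize (n - 1) (cov a b (\<beta> (n, i)) (sym2 g ** h)) z = homogenize (n - 1) (cov a b (\<beta> (n, i)) h) (z v* g)" for h
          using homogenize_cov_sym2[OF \<beta>_mem[OF True], of g h z] g by (simp add: dim[OF True] SL2_def)
        then show ?thesis using True
          by (simp add: p sum_fun_apply irr_sum_def Sym_def \<eta>_def comb homogenize_sum[symmetric])
      next
        case False
        then show ?thesis by (simp add: p sum_fun_apply irr_sum_def Sym_def \<eta>_def comb)
      qed
    qed
    finally show ?thesis using T_comb[OF A(2)] by (simp add: m)
  qed
  ultimately show ?thesis
    unfolding isomorphic_gmodules_def N_def[symmetric]
    by (intro exI[of _ T]) (simp add: bij_betw_def pullback_def T.add T.scale)
qed

section \<open>The multiset of summands\<close>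

text \<open>The values \<open>k + l\<close> on the rectangle have multiplicities that rise, stay
  constant and fall; peeling off layers of multiplicity one gives the nested intervals on the
  right.\<close>

lemma sum_trapezoid:
  fixes f :: "nat \<Rightarrow> 'a::comm_monoid_add"
  assumes "n \<le> m"
  shows "(\<Sum>k<m. \<Sum>l<n. f (k + l)) = (\<Sum>l<n. \<Sum>j\<in>{l..<m + n - 1 - l}. f j)"
  using assms
proof (induction n)
  case (Suc n)
  have shift: "(\<Sum>k<m. f (k + n)) = (\<Sum>j\<in>{n..<m + n}. f j)"
    using sum.shift_bounds_nat_ivl[of f 0 n m] by (simp add: atLeast0LessThan)
  \<comment> \<open>The interval of the new row splits: its last \<open>n\<close> points lengthen
    the \<open>n\<close> earlier intervals by one point each, and the rest, \<open>{n..<m}\<close>,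
    is the new innermost interval.\<close>
  have "(\<Sum>l<n. f (m + n - 1 - l)) = (\<Sum>j\<in>{m..<m + n}. f j)"
    by (rule sum.reindex_bij_witness[of _ "\<lambda>j. m + n - 1 - j" "\<lambda>l. m + n - 1 - l"]) auto
  then have tail: "(\<Sum>l<n. f (m + n - 1 - l)) + (\<Sum>j\<in>{n..<m}. f j) = (\<Sum>j\<in>{n..<m + n}. f j)"
    using sum.atLeastLessThan_concat[of n m "m + n" f] Suc.prems by (simp add: add.commute)
  have row: "(\<Sum>j\<in>{l..<m + n - l}. f j) = (\<Sum>j\<in>{l..<m + n - 1 - l}. f j) + f (m + n - 1 - l)" if "l < n" for l
  proof -
    have "m + n - l = Suc (m + n - 1 - l)" "l \<le> m + n - 1 - l" using that Suc.prems by linarith+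
    then show ?thesis by simp
  qed
  have "(\<Sum>k<m. \<Sum>l<Suc n. f (k + l)) = (\<Sum>l<n. \<Sum>j\<in>{l..<m + n - 1 - l}. f j) + (\<Sum>j\<in>{n..<m + n}. f j)"
    using Suc by (simp add: sum.distrib shift)
  also have "\<dots> = (\<Sum>l<n. \<Sum>j\<in>{l..<m + n - l}. f j) + (\<Sum>j\<in>{n..<m}. f j)"
    by (simp add: row sum.distrib tail[symmetric] add.assoc)
  finally show ?case using Suc.prems by simp
qed simp

lemma sum_even_odd:
  fixes f :: "nat \<Rightarrow> 'a::comm_monoid_add"
  assumes "l \<le> m"
  shows "(\<Sum>j\<in>{l..<m}. f (2 * j)) + (\<Sum>j\<in>{l..<m}. f (2 * j + 1)) = (\<Sum>i\<in>{2 * l..<2 * m}. f i)"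
    and "(\<Sum>j\<in>{l..<Suc m}. f (2 * j)) + (\<Sum>j\<in>{l..<m}. f (2 * j + 1)) = (\<Sum>i\<in>{2 * l..<2 * m + 1}. f i)"
proof -
  show 1: "(\<Sum>j\<in>{l..<m}. f (2 * j)) + (\<Sum>j\<in>{l..<m}. f (2 * j + 1)) = (\<Sum>i\<in>{2 * l..<2 * m}. f i)"
    using assms by (induction m rule: dec_induct) (simp_all add: add_ac)
  have "(\<Sum>j\<in>{l..<Suc m}. f (2 * j)) + (\<Sum>j\<in>{l..<m}. f (2 * j + 1))
      = ((\<Sum>j\<in>{l..<m}. f (2 * j)) + (\<Sum>j\<in>{l..<m}. f (2 * j + 1))) + f (2 * m)"
    using assms by (simp add: add_ac)
  then show "(\<Sum>j\<in>{l..<Suc m}. f (2 * j)) + (\<Sum>j\<in>{l..<m}. f (2 * j + 1)) = (\<Sum>i\<in>{2 * l..<2 * m + 1}. f i)"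
    unfolding 1 using assms by simp
qed

lemma sum_reverse:
  fixes f :: "nat \<Rightarrow> 'a::comm_monoid_add"
  assumes "q \<le> s + 1" "p \<le> s"
  shows "(\<Sum>i\<in>{p..<q}. f (s - i)) = (\<Sum>j\<in>{s + 1 - q..s - p}. f j)"
  using assms by (intro sum.reindex_bij_witness[of _ "\<lambda>j. s - j" "\<lambda>i. s - i"]) auto

lemma sum_peel_two:
  fixes f :: "nat \<Rightarrow> 'a::comm_monoid_add"
  assumes "p + 3 \<le> q"
  shows "(\<Sum>j=p..q. f j) = f p + f (p + 1) + f (q - 1) + f q + (\<Sum>j=p + 2..q - 2. f j)"
proof -
  have eq: "{p..q} = insert p (insert (p + 1) (insert (q - 1) (insert q {p + 2..q - 2})))"
    using assms by auto
  have "p \<notin> insert (p + 1) (insert (q - 1) (insert q {p + 2..q - 2}))"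
    "p + 1 \<notin> insert (q - 1) (insert q {p + 2..q - 2})"
    "q - 1 \<notin> insert q {p + 2..q - 2}" "q \<notin> {p + 2..q - 2}" using assms by auto
  then show ?thesis unfolding eq by (simp only: sum.insert finite_insert finite_atLeastAtMost not_False_eq_True add.assoc)
qed

text \<open>Each interval arises from the previous one by removing two points at each end. The
  \<open>k\<close>-th quadruple removed thus belongs to exactly the first \<open>k\<close>
  intervals, and what remains at the end belongs to all \<open>n\<close>. The inequality assumed
  ensures that four points are available at each removal.\<close>

lemma sum_nested_intervals:
  fixes G :: "nat \<Rightarrow> 'a multiset"
    and n d s :: nat
  defines "Q \<equiv> \<lambda>k. G (2*k-2+d) + G (2*k-1+d) + G (s-2*k+1) + G (s-2*k+2)"
  assumes "4 * n + d \<le> s + 1"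
  shows "(\<Sum>l<n. \<Sum>j=2*l+d..s-2*l. G j) =
    (\<Sum>k=1..n. repeat_mset k (Q k)) + repeat_mset n (\<Sum>j=2*n+d..s-2*n. G j)"
  using assms(2)
proof (induction n)
  case (Suc n)
  have peel: "(\<Sum>j=2*n+d..s-2*n. G j) = Q (Suc n) + (\<Sum>j=2*Suc n+d..s-2*Suc n. G j)"
  proof -
    have inner: "2*n+d+1 = 2*Suc n-1+d" "2*n+d+2 = 2*Suc n+d" "s-2*n-1 = s-2*Suc n+1" "s-2*n-2 = s-2*Suc n"
      and outer: "2*n+d = 2*Suc n-2+d" "s-2*n = s-2*Suc n+2"
      using Suc.prems by auto
    have "2*n+d + 3 \<le> s-2*n" using Suc.prems by auto
    from sum_peel_two[OF this, of G] show ?thesis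
      unfolding Q_def inner unfolding outer .
  qed
  have "(\<Sum>l<Suc n. \<Sum>j=2*l+d..s-2*l. G j) =
    ((\<Sum>k=1..n. repeat_mset k (Q k)) + repeat_mset n (\<Sum>j=2*n+d..s-2*n. G j)) + (\<Sum>j=2*n+d..s-2*n. G j)"
    using Suc.IH Suc.prems by simp
  also have "\<dots> = (\<Sum>k=1..n. repeat_mset k (Q k)) + repeat_mset (Suc n) (\<Sum>j=2*n+d..s-2*n. G j)"
    by (simp only: repeat_mset_Suc add_ac)
  also have "\<dots> = ((\<Sum>k=1..n. repeat_mset k (Q k)) + repeat_mset (Suc n) (Q (Suc n)))
      + repeat_mset (Suc n) (\<Sum>j=2*Suc n+d..s-2*Suc n. G j)"
    unfolding peel repeat_mset_distrib2 by (simp only: add.assoc)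
  also have "(\<Sum>k=1..n. repeat_mset k (Q k)) + repeat_mset (Suc n) (Q (Suc n)) = (\<Sum>k=1..Suc n. repeat_mset k (Q k))"
    by (simp add: sum.cl_ivl_Suc del: repeat_mset_Suc)
  finally show ?case .
qed simp

text \<open>The dimension attached to \<open>(e, k, l)\<close> depends only on \<open>e\<close> and
  \<open>k + l\<close>, so \<open>sum_trapezoid\<close> applies to the rectangles for
  \<open>e = 0\<close> and \<open>e = 1\<close> separately.\<close>

lemma cov_multiset_eq:
  assumes "b \<le> a"
  defines "G \<equiv> \<lambda>j. {#2 * j + 1#}" and "s \<equiv> a + b"
  shows "(\<Sum>x\<in>cov_index a b. {#cov_order a b x + 1#}) =
    (\<Sum>l<b div 2 + 1. \<Sum>j\<in>{l..<a div 2 + b div 2 + 1 - l}. G (s - 2 * j))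
    + (\<Sum>l<(b + 1) div 2. \<Sum>j\<in>{l..<(a + 1) div 2 + (b + 1) div 2 - 1 - l}. G (s - (2 * j + 1)))"
proof -
  have "(\<Sum>x\<in>cov_index a b. {#cov_order a b x + 1#}) =
      (\<Sum>k<a div 2 + 1. \<Sum>l<b div 2 + 1. G (s - 2 * (k + l)))
      + (\<Sum>k<(a + 1) div 2. \<Sum>l<(b + 1) div 2. G (s - (2 * (k + l) + 1)))"
    unfolding sum_cov_index by (simp add: cov_order_def G_def s_def algebra_simps)
  also have "(\<Sum>k<a div 2 + 1. \<Sum>l<b div 2 + 1. G (s - 2 * (k + l)))
      = (\<Sum>l<b div 2 + 1. \<Sum>j\<in>{l..<a div 2 + b div 2 + 1 - l}. G (s - 2 * j))"
    using sum_trapezoid[of "b div 2 + 1" "a div 2 + 1" "\<lambda>j. G (s - 2 * j)"] div_le_mono[OF assms(1), of 2]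
    by simp
  also have "(\<Sum>k<(a + 1) div 2. \<Sum>l<(b + 1) div 2. G (s - (2 * (k + l) + 1)))
      = (\<Sum>l<(b + 1) div 2. \<Sum>j\<in>{l..<(a + 1) div 2 + (b + 1) div 2 - 1 - l}. G (s - (2 * j + 1)))"
    by (rule sum_trapezoid) (use assms(1) in \<open>simp add: div_le_mono\<close>)
  finally show ?thesis .
qed

text \<open>For odd \<open>b\<close> there are equally many rows for \<open>e = 0\<close> and
  \<open>e = 1\<close>. Counted downwards from the top of the interval they supply alternate terms
  without a gap; the parity of \<open>a\<close> only decides which of them supplies the last
  term.\<close>

lemma cov_multiset_odd:
  assumes "b \<le> a" "b = 2 * t + 1" "s = a + b"
  shows "(\<Sum>x\<in>cov_index a b. {#cov_order a b x + 1#}) = (\<Sum>l<t + 1. \<Sum>j=2*l+1..s-2*l. {#2 * j + 1#})"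
proof -
  let ?G = "\<lambda>j. {#2 * j + 1#}"
  define M0 where "M0 l = a div 2 + t + 1 - l" for l
  define M1 where "M1 l = (a + 1) div 2 + t - l" for l
  have t: "b div 2 = t" "(b + 1) div 2 = t + 1" using assms(2) by auto
  have row: "(\<Sum>j\<in>{l..<M0 l}. ?G (s - 2 * j)) + (\<Sum>j\<in>{l..<M1 l}. ?G (s - (2 * j + 1)))
      = (\<Sum>j=2*l+1..s-2*l. ?G j)" if "l < t + 1" for l
  proof -
    have l: "l \<le> t" using that by simp
    have "(\<Sum>j\<in>{l..<M0 l}. ?G (s - 2 * j)) + (\<Sum>j\<in>{l..<M1 l}. ?G (s - (2 * j + 1)))
        = (\<Sum>i\<in>{2 * l..<s - 2 * l}. ?G (s - i))"
    proof (cases "even a")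
      case True
      then obtain c where c: "a = 2 * c" by (elim evenE)
      have "M1 l = c + t - l" "M0 l = Suc (M1 l)" "l \<le> M1 l" "2 * M1 l + 1 = s - 2 * l"
        using assms l by (auto simp: M0_def M1_def c)
      then show ?thesis using sum_even_odd(2)[of l "M1 l" "\<lambda>i. ?G (s - i)"] by (simp only:)
    next
      case False
      then obtain c where c: "a = 2 * c + 1" by (elim oddE)
      have "M0 l = M1 l" "l \<le> M1 l" "2 * M1 l = s - 2 * l"
        using assms l by (auto simp: M0_def M1_def c)
      then show ?thesis using sum_even_odd(1)[of l "M1 l" "\<lambda>i. ?G (s - i)"] by (simp only:)
    qed
    also have "\<dots> = (\<Sum>j=s+1-(s-2*l)..s-2*l. ?G j)" using assms l by (intro sum_reverse) auto
    also have "s + 1 - (s - 2 * l) = 2 * l + 1" using assms l by auto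
    finally show ?thesis .
  qed
  have "(\<Sum>x\<in>cov_index a b. {#cov_order a b x + 1#}) =
      (\<Sum>l<t + 1. (\<Sum>j\<in>{l..<M0 l}. ?G (s - 2 * j)) + (\<Sum>j\<in>{l..<M1 l}. ?G (s - (2 * j + 1))))"
    unfolding cov_multiset_eq[OF assms(1)] t M0_def M1_def assms(3)[symmetric] sum.distrib by simp
  also have "\<dots> = (\<Sum>l<t + 1. \<Sum>j=2*l+1..s-2*l. ?G j)" by (intro sum.cong refl row) simp
  finally show ?thesis .
qed

text \<open>There is one more row for \<open>e = 0\<close> than for \<open>e = 1\<close>. The first
  \<open>t\<close> rows interleave to full intervals, and the unmatched row \<open>l = t\<close>
  gives the summands \<open>4 * j + 3\<close>.\<close>

lemma cov_multiset_odd_even: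
  assumes "b \<le> a" "a = 2 * c + 1" "b = 2 * t" "s = a + b"
  shows "(\<Sum>x\<in>cov_index a b. {#cov_order a b x + 1#}) =
    (\<Sum>l<t. \<Sum>j=2*l+1..s-2*l. {#2 * j + 1#}) + (\<Sum>j=t..c. {#4 * j + 3#})"
proof -
  let ?G = "\<lambda>j. {#2 * j + 1#}"
  have div: "b div 2 = t" "(b + 1) div 2 = t" "a div 2 = c" "(a + 1) div 2 = c + 1" using assms by auto
  have row: "(\<Sum>j\<in>{l..<c + t + 1 - l}. ?G (s - 2 * j)) + (\<Sum>j\<in>{l..<c + t - l}. ?G (s - (2 * j + 1)))
      = (\<Sum>j=2*l+1..s-2*l. ?G j)" if l: "l < t" for l
  proof -
    have "l \<le> c + t - l" "c + t + 1 - l = Suc (c + t - l)" "2 * (c + t - l) + 1 = s - 2 * l"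
      using assms l by auto
    then have "(\<Sum>j\<in>{l..<c + t + 1 - l}. ?G (s - 2 * j)) + (\<Sum>j\<in>{l..<c + t - l}. ?G (s - (2 * j + 1)))
        = (\<Sum>i\<in>{2 * l..<s - 2 * l}. ?G (s - i))"
      using sum_even_odd(2)[of l "c + t - l" "\<lambda>i. ?G (s - i)"] by (simp only:)
    also have "\<dots> = (\<Sum>j=s+1-(s-2*l)..s-2*l. ?G j)" using assms l by (intro sum_reverse) auto
    also have "s + 1 - (s - 2 * l) = 2 * l + 1" using assms l by auto
    finally show ?thesis .
  qed
  have last: "(\<Sum>j\<in>{t..<c + 1}. ?G (s - 2 * j)) = (\<Sum>j=t..c. {#4 * j + 3#})"
    using assms by (intro sum.reindex_bij_witness[of _ "\<lambda>j. c + t - j" "\<lambda>j. c + t - j"]) auto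
  have "(\<Sum>x\<in>cov_index a b. {#cov_order a b x + 1#}) =
      (\<Sum>l<t. (\<Sum>j\<in>{l..<c + t + 1 - l}. ?G (s - 2 * j)) + (\<Sum>j\<in>{l..<c + t - l}. ?G (s - (2 * j + 1))))
      + (\<Sum>j\<in>{t..<c + 1}. ?G (s - 2 * j))"
    unfolding cov_multiset_eq[OF assms(1)] div assms(4)[symmetric] sum.distrib by (simp add: add_ac)
  also have "(\<Sum>l<t. (\<Sum>j\<in>{l..<c + t + 1 - l}. ?G (s - 2 * j)) + (\<Sum>j\<in>{l..<c + t - l}. ?G (s - (2 * j + 1))))
      = (\<Sum>l<t. \<Sum>j=2*l+1..s-2*l. ?G j)" by (intro sum.cong refl row) simp
  finally show ?thesis unfolding last .
qed

text \<open>Each row for \<open>e = 0\<close> exceeds its partner by two terms, so interleaving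
  leaves the term \<open>4 * l + 1\<close> over. These leftovers for \<open>l < t\<close> and the
  unmatched row \<open>l = t\<close> combine to the last sum.\<close>

lemma cov_multiset_even_even:
  assumes "b \<le> a" "a = 2 * c" "b = 2 * t" "s = a + b"
  shows "(\<Sum>x\<in>cov_index a b. {#cov_order a b x + 1#}) =
    (\<Sum>l<t. \<Sum>j=2*l+2..s-2*l. {#2 * j + 1#}) + (\<Sum>k=0..c. {#4 * k + 1#})"
proof -
  let ?G = "\<lambda>j. {#2 * j + 1#}"
  have div: "b div 2 = t" "(b + 1) div 2 = t" "a div 2 = c" "(a + 1) div 2 = c" using assms by auto
  have row: "(\<Sum>j\<in>{l..<c + t + 1 - l}. ?G (s - 2 * j)) + (\<Sum>j\<in>{l..<c + t - 1 - l}. ?G (s - (2 * j + 1)))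
      = (\<Sum>j=2*l+2..s-2*l. ?G j) + {#4 * l + 1#}" if l: "l < t" for l
  proof -
    define m where "m = c + t - 1 - l"
    have m: "l \<le> m" "c + t - l = Suc m" "2 * m + 1 = s - 1 - 2 * l"
      using assms l by (auto simp: m_def)
    have "(\<Sum>j\<in>{l..<c + t + 1 - l}. ?G (s - 2 * j)) = (\<Sum>j\<in>{l..<Suc m}. ?G (s - 2 * j)) + ?G (s - 2 * Suc m)"
    proof -
      have "c + t + 1 - l = Suc (Suc m)" using assms l by (auto simp: m_def)
      then show ?thesis using m(1) by simp
    qed
    moreover have "?G (s - 2 * Suc m) = {#4 * l + 1#}" using assms l by (simp add: m_def)
    moreover have "(\<Sum>j\<in>{l..<Suc m}. ?G (s - 2 * j)) + (\<Sum>j\<in>{l..<m}. ?G (s - (2 * j + 1)))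
        = (\<Sum>i\<in>{2 * l..<s - 1 - 2 * l}. ?G (s - i))"
      unfolding m(3)[symmetric] using sum_even_odd(2)[OF m(1), of "\<lambda>i. ?G (s - i)"] by simp
    moreover have "\<dots> = (\<Sum>j=s+1-(s-1-2*l)..s-2*l. ?G j)" using assms l by (intro sum_reverse) auto
    moreover have "s + 1 - (s - 1 - 2 * l) = 2 * l + 2" using assms l by auto
    ultimately show ?thesis unfolding m_def[symmetric] by (simp only: add_ac)
  qed
  have last: "(\<Sum>j\<in>{t..<c + 1}. ?G (s - 2 * j)) = (\<Sum>j=t..c. {#4 * j + 1#})"
    using assms by (intro sum.reindex_bij_witness[of _ "\<lambda>j. c + t - j" "\<lambda>j. c + t - j"]) auto
  have "(\<Sum>x\<in>cov_index a b. {#cov_order a b x + 1#}) =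
      (\<Sum>l<t. (\<Sum>j\<in>{l..<c + t + 1 - l}. ?G (s - 2 * j)) + (\<Sum>j\<in>{l..<c + t - 1 - l}. ?G (s - (2 * j + 1))))
      + (\<Sum>j\<in>{t..<c + 1}. ?G (s - 2 * j))"
    unfolding cov_multiset_eq[OF assms(1)] div assms(4)[symmetric] sum.distrib by (simp add: add_ac)
  also have "(\<Sum>l<t. (\<Sum>j\<in>{l..<c + t + 1 - l}. ?G (s - 2 * j)) + (\<Sum>j\<in>{l..<c + t - 1 - l}. ?G (s - (2 * j + 1))))
      = (\<Sum>l<t. (\<Sum>j=2*l+2..s-2*l. ?G j) + {#4 * l + 1#})" by (intro sum.cong refl row) simp
  also have "\<dots> = (\<Sum>l<t. \<Sum>j=2*l+2..s-2*l. ?G j) + (\<Sum>l\<in>{0..<t}. {#4 * l + 1#})"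
    by (simp only: sum.distrib atLeast0LessThan)
  finally have "(\<Sum>x\<in>cov_index a b. {#cov_order a b x + 1#}) = (\<Sum>l<t. \<Sum>j=2*l+2..s-2*l. ?G j)
      + ((\<Sum>l\<in>{0..<t}. {#4 * l + 1#}) + (\<Sum>j\<in>{t..<Suc c}. {#4 * j + 1#}))"
    unfolding last atLeastLessThanSuc_atLeastAtMost by (simp only: add.assoc)
  also have "(\<Sum>l\<in>{0..<t}. {#4 * l + 1#}) + (\<Sum>j\<in>{t..<Suc c}. {#4 * j + 1#}) = (\<Sum>k=0..c. {#4 * k + 1#})"
    using assms by (subst sum.atLeastLessThan_concat) (auto simp: atLeastLessThanSuc_atLeastAtMost)
  finally show ?thesis .
qed

theorem theorem3p1:
  fixes a b s r p t :: nat
    and \<pi> :: "(complex^3^3, 'v::ab_group_add) gmodule"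
  assumes "b \<le> a"
    and "irreducible_GL3_with_highest_weight \<pi> (int a *s omega1 + int b *s omega2)"
    and "s = a + b" and "r = 2 * s + 2" and "p = s div 2" and "t = b div 2"
  shows "(b = 0 \<longrightarrow>
           isomorphic_gmodules SL2 (pullback sym2 \<pi>)
             (irr_sum (\<Sum>k=0..p. {#2*a - 4*k + 1#}))) \<and>
         (b \<ge> 1 \<and> odd b \<longrightarrow>
           isomorphic_gmodules SL2 (pullback sym2 \<pi>)
             (irr_sum
               ((\<Sum>k=1..t. repeat_mset k {#4*k - 1, 4*k + 1, r - 4*k + 1, r - 4*k + 3#})
                + repeat_mset (t + 1) (\<Sum>j=2*t+1..s-2*t. {#2*j + 1#})))) \<and>
         (b \<ge> 1 \<and> odd a \<and> even b \<longrightarrow>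
           isomorphic_gmodules SL2 (pullback sym2 \<pi>)
             (irr_sum
               ((\<Sum>k=1..t. repeat_mset k {#4*k - 1, 4*k + 1, r - 4*k + 1, r - 4*k + 3#})
                + repeat_mset t (\<Sum>j=2*t+1..s-2*t. {#2*j + 1#})
                + (\<Sum>j=t..p-t. {#4*j + 3#})))) \<and>
         (b \<ge> 1 \<and> even a \<and> even b \<longrightarrow>
           isomorphic_gmodules SL2 (pullback sym2 \<pi>)
             (irr_sum
               ((\<Sum>k=1..t-1. repeat_mset k {#4*k + 1, 4*k + 3, r - 4*k + 1, r - 4*k + 3#})
                + repeat_mset t (\<Sum>j=2*t..s-2*t+2. {#2*j + 1#})
                + (\<Sum>k=0..(s-2*t) div 2. {#4*k + 1#}))))"
proof -
  define N where "N = (\<Sum>x\<in>cov_index a b. {#cov_order a b x + 1#})"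
  let ?G = "\<lambda>j::nat. {#2 * j + 1#}"
  have iso: "isomorphic_gmodules SL2 (pullback sym2 \<pi>) (irr_sum N)"
    unfolding N_def by (rule sym2_restriction[OF assms(2)])
  \<comment> \<open>Translates labels near the upper end into the notation with \<open>r\<close>;
    \<open>k \<le> t\<close> keeps the differences of naturals genuine.\<close>
  have top: "2 * (s - 2*k + 1) + 1 = r - 4*k + 1" "2 * (s - 2*k + 2) + 1 = r - 4*k + 3"
    if "k \<le> t" for k
    using that assms(1,3,4,6) by auto
  have quad1: "?G (2*k-2+1) + ?G (2*k-1+1) + ?G (s-2*k+1) + ?G (s-2*k+2)
      = {#4*k - 1, 4*k + 1, r - 4*k + 1, r - 4*k + 3#}" if "k \<in> {1..t}" for k
  proof -
    have "2 * (2*k-2+1) + 1 = 4*k - 1" "2 * (2*k-1+1) + 1 = 4*k + 1" using that by auto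
    then show ?thesis using that by (simp only: top atLeastAtMost_iff) simp
  qed
  have quad2: "?G (2*k-2+2) + ?G (2*k-1+2) + ?G (s-2*k+1) + ?G (s-2*k+2)
      = {#4*k + 1, 4*k + 3, r - 4*k + 1, r - 4*k + 3#}" if "k \<in> {1..t-1}" for k
  proof -
    have "2 * (2*k-2+2) + 1 = 4*k + 1" "2 * (2*k-1+2) + 1 = 4*k + 3" "k \<le> t" using that by auto
    then show ?thesis by (simp only: top) simp
  qed
  have nested1: "(\<Sum>l<t. \<Sum>j=2*l+1..s-2*l. ?G j) =
      (\<Sum>k=1..t. repeat_mset k {#4*k - 1, 4*k + 1, r - 4*k + 1, r - 4*k + 3#})
      + repeat_mset t (\<Sum>j=2*t+1..s-2*t. ?G j)"
  proof -
    have "4 * t + 1 \<le> s + 1" using assms(1,3,6) by auto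
    from sum_nested_intervals[OF this, of ?G] show ?thesis
      by (simp only: quad1 cong: sum.cong)
  qed
  \<comment> \<open>For \<open>b = 0\<close> the formulas for even \<open>b\<close> apply with
    \<open>t = 0\<close>; reversing the summation by \<open>c - k\<close> gives the stated
    form.\<close>
  have "N = (\<Sum>k=0..p. {#2*a - 4*k + 1#})" if "b = 0"
  proof (cases "even a")
    case True
    then obtain c where c: "a = 2 * c" by (elim evenE)
    have "N = (\<Sum>k=0..c. {#4 * k + 1#})"
      using cov_multiset_even_even[of b a c 0 s] that assms(3) c by (simp add: N_def)
    also have "\<dots> = (\<Sum>k=0..p. {#2*a - 4*k + 1#})"
      using c that assms(3,5) by (intro sum.reindex_bij_witness[of _ "\<lambda>k. c - k" "\<lambda>k. c - k"]) auto
    finally show ?thesis .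
  next
    case False
    then obtain c where c: "a = 2 * c + 1" by (elim oddE)
    have "N = (\<Sum>j=0..c. {#4 * j + 3#})"
      using cov_multiset_odd_even[of b a c 0 s] that assms(3) c by (simp add: N_def)
    also have "\<dots> = (\<Sum>k=0..p. {#2*a - 4*k + 1#})"
      using c that assms(3,5) by (intro sum.reindex_bij_witness[of _ "\<lambda>k. c - k" "\<lambda>k. c - k"]) auto
    finally show ?thesis .
  qed
  moreover have "N = (\<Sum>k=1..t. repeat_mset k {#4*k - 1, 4*k + 1, r - 4*k + 1, r - 4*k + 3#})
      + repeat_mset (t + 1) (\<Sum>j=2*t+1..s-2*t. {#2*j + 1#})" if "odd b"
  proof -
    have "b = 2 * t + 1" using that assms(6) by simp
    then have "N = (\<Sum>l<t + 1. \<Sum>j=2*l+1..s-2*l. ?G j)"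
      unfolding N_def by (rule cov_multiset_odd[OF assms(1) _ assms(3)])
    \<comment> \<open>The innermost interval \<open>l = t\<close> is split off unpeeled; it raises
      the multiplicity of its points from \<open>t\<close> to \<open>t + 1\<close>.\<close>
    also have "\<dots> = (\<Sum>l<t. \<Sum>j=2*l+1..s-2*l. ?G j) + (\<Sum>j=2*t+1..s-2*t. ?G j)" by simp
    finally have "N = (\<Sum>l<t. \<Sum>j=2*l+1..s-2*l. ?G j) + (\<Sum>j=2*t+1..s-2*t. ?G j)" .
    moreover have "repeat_mset (t + 1) X = repeat_mset t X + X" for X :: "nat multiset"
      by (simp add: add.commute)
    ultimately show ?thesis unfolding nested1 by (simp only: add.assoc)
  qed
  moreover have "N = (\<Sum>k=1..t. repeat_mset k {#4*k - 1, 4*k + 1, r - 4*k + 1, r - 4*k + 3#})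
      + repeat_mset t (\<Sum>j=2*t+1..s-2*t. {#2*j + 1#}) + (\<Sum>j=t..p-t. {#4*j + 3#})" if parity: "odd a" "even b"
  proof -
    obtain c where c: "a = 2 * c + 1" using parity(1) by (elim oddE)
    have b: "b = 2 * t" and "p - t = c" using parity c assms(3,5,6) by auto
    then show ?thesis
      unfolding N_def cov_multiset_odd_even[OF assms(1) c b assms(3)] nested1 by simp
  qed
  moreover have "N = (\<Sum>k=1..t-1. repeat_mset k {#4*k + 1, 4*k + 3, r - 4*k + 1, r - 4*k + 3#})
      + repeat_mset t (\<Sum>j=2*t..s-2*t+2. {#2*j + 1#}) + (\<Sum>k=0..(s-2*t) div 2. {#4*k + 1#})"
    if parity: "b \<ge> 1" "even a" "even b"
  proof -
    obtain c where c: "a = 2 * c" using parity(2) by (elim evenE)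
    have b: "b = 2 * t" and dc: "(s - 2 * t) div 2 = c" using parity c assms(3,6) by auto
    obtain n where n: "t = Suc n" using b parity(1) by (cases t) auto
    \<comment> \<open>Only \<open>n = t - 1\<close> intervals are peeled, with offset
      \<open>d = 2\<close>; the last one, \<open>l = n\<close>, runs from \<open>2 * t\<close> to
      \<open>s - 2 * t + 2\<close> and raises the multiplicity there from \<open>n\<close> to
      \<open>t\<close>.\<close>
    have "4 * n + 2 \<le> s + 1" and ends: "2*n+2 = 2*t" "s-2*n = s-2*t+2" using n b c assms(1,3) by auto
    have pred: "t - 1 = n" using n by simp
    have "(\<Sum>l<n. \<Sum>j=2*l+2..s-2*l. ?G j) =
        (\<Sum>k=1..t-1. repeat_mset k {#4*k + 1, 4*k + 3, r - 4*k + 1, r - 4*k + 3#})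
        + repeat_mset n (\<Sum>j=2*t..s-2*t+2. ?G j)"
      using sum_nested_intervals[OF \<open>4 * n + 2 \<le> s + 1\<close>, of ?G]
      unfolding ends pred by (simp only: quad2[unfolded pred] cong: sum.cong)
    moreover have "(\<Sum>l<t. \<Sum>j=2*l+2..s-2*l. ?G j) =
        (\<Sum>l<n. \<Sum>j=2*l+2..s-2*l. ?G j) + (\<Sum>j=2*t..s-2*t+2. ?G j)"
      using sum.lessThan_Suc[of "\<lambda>l. \<Sum>j=2*l+2..s-2*l. ?G j" n] unfolding ends n[symmetric] .
    moreover have "repeat_mset t X = repeat_mset n X + X" for X :: "nat multiset"
      by (simp add: n add.commute)
    ultimately have "(\<Sum>l<t. \<Sum>j=2*l+2..s-2*l. ?G j) =
        (\<Sum>k=1..t-1. repeat_mset k {#4*k + 1, 4*k + 3, r - 4*k + 1, r - 4*k + 3#})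
        + repeat_mset t (\<Sum>j=2*t..s-2*t+2. ?G j)"
      by (simp only: add.assoc)
    then show ?thesis
      unfolding N_def cov_multiset_even_even[OF assms(1) c b assms(3)] dc by simp
  qed
  ultimately show ?thesis using iso by auto
qed

end
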